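(* For every integer $d\ge 1$ there is a constant $C_d>0$, depending only on $d$, such that the following holds. Let $n\ge 1$, let $P(\lambda)=\sum_{i=0}^d A_i\lambda^i$ be a regular $n\times n$ complex matrix polynomial of degree $d$, let $\ell\ge 1$ be a divisor of $d$, let $\mathcal{L}(\lambda)=\sum_{i=0}^{\ell}\mathcal{L}_i\lambda^i$ be a block Kronecker companion form (of grade $\ell$) of $P(\lambda)$, and let $\lambda_0$ be a simple, finite, nonzero eigenvalue of $P(\lambda)$. (a) If $\max_{0\le i\le d}\|A_i\|_2=1$, then $$\frac{\mathrm{coeff\,cond}_{\mathcal{L}}(\lambda_0)}{\mathrm{norm\,cond}_{P}(\lambda_0)}\le C_d .$$ (b) If $\max_{0\le i\le d}\|A_i\|_2=1$ and $\min\{\|A_0\|_2,\|A_d\|_2\}=1$, then $$\frac{\mathrm{coeff\,cond}_{\mathcal{L}}(\lambda_0)}{\mathrm{coeff\,cond}_{P}(\lambda_0)}\le C_d .$$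
   Context: A matrix polynomial $P(\lambda)=\sum_{i=0}^d A_i\lambda^i$, $A_i\in\mathbb{C}^{n\times n}$, is regular if $\det P(\lambda)\not\equiv 0$; it has degree $d$ if $A_d\ne0$, and grade $d$ if $A_d$ is allowed to be zero. Right/left eigenvectors of $P$ for an eigenvalue $\lambda_0$ are nonzero $x,y$ with $P(\lambda_0)x=0$, $y^*P(\lambda_0)=0$. Condition numbers: for a simple, finite, nonzero eigenvalue $\lambda_0$ of a matrix polynomial $P(\lambda)=\sum_{i=0}^d A_i\lambda^i$ with right and left eigenvectors $x,y$, $$\mathrm{coeff\,cond}_P(\lambda_0)=\frac{\left(\sum_{i=0}^d|\lambda_0|^i\|A_i\|_2\right)\|x\|_2\|y\|_2}{|\lambda_0|\,|y^*P'(\lambda_0)x|},\qquad \mathrm{norm\,cond}_P(\lambda_0)=\frac{\|[A_0\ \cdots\ A_d]\|_2\left(\sum_{i=0}^d|\lambda_0|^i\right)\|x\|_2\|y\|_2}{|\lambda_0|\,|y^*P'(\lambda_0)x|}.$$ For $\mathcal{L}(\lambda)=\sum_{i=0}^\ell\mathcal{L}_i\lambda^i$, $\mathrm{coeff\,cond}_{\mathcal{L}}(\lambda_0)$ is given by the same formula with $\mathcal{L}_i$, $\ell$ and the right/left eigenvectors of $\mathcal{L}$. ($\lambda_0$ is also a simple eigenvalue of $\mathcal{L}$.) For $k\ge0$, $L_k(\lambda)$ is the $k\times(k+1)$ matrix with entries $-1$ at positions $(i,i)$, $\lambda$ at positions $(i,i+1)$, and $0$ elsewhere ($L_0$ is the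 empty $0\times1$ matrix, and the corresponding block row/column below is absent), and $\Lambda_k(\lambda)=[\lambda^k\ \lambda^{k-1}\ \cdots\ \lambda\ 1]^T$. $\otimes$ is the Kronecker product. Block Kronecker companion form: let $\ell$ divide $d$ and let $\epsilon,\eta\ge0$ be integers with $\epsilon+\eta+1=d/\ell$. An $(\epsilon,n,\eta,n)$-block Kronecker $\ell$-ification of $P$ is a matrix polynomial $$\mathcal{L}(\lambda)=\begin{bmatrix} M(\lambda) & L_\eta(\lambda^\ell)^T\otimes I_n\\ L_\epsilon(\lambda^\ell)\otimes I_n & 0\end{bmatrix},\qquad M(\lambda)=\sum_{t=0}^\ell M_t\lambda^t\in\mathbb{C}[\lambda]^{(\eta+1)n\times(\epsilon+1)n},$$ with $(\Lambda_\eta(\lambda^\ell)^T\otimes I_n)M(\lambda)(\Lambda_\epsilon(\lambda^\ell)\otimes I_n)=P(\lambda)$. It is a block Kronecker companion form (companion $\ell$-ification) of $P$ if moreover, viewing each $M_t$ as an $(\eta+1)\times(\epsilon+1)$ block matrix with $n\times n$ blocks, every block of every $M_t$ is either $0$, $I_n$, or $A_i$ for some $i\in\{0,\dots,d\}$. *)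

theory Defs
  imports "Jordan_Normal_Form.Char_Poly" "Jordan_Normal_Form.Conjugate"
begin

section \<open>Norms\<close>

definition l2_norm :: "complex vec \<Rightarrow> real" where
  "l2_norm v = sqrt (\<Sum>i<dim_vec v. (cmod (v $ i))\<^sup>2)"

(* the operator norm induced by l2_norm *)
definition spectral_norm :: "complex mat \<Rightarrow> real" where
  "spectral_norm A =
    (SUP v \<in> {v \<in> carrier_vec (dim_col A). l2_norm v \<le> 1}. l2_norm (A *\<^sub>v v))"

section \<open>Matrix polynomials\<close>

text \<open>A matrix polynomial is represented as a matrix with polynomial entries.\<close>

definition mp_coeff :: "complex poly mat \<Rightarrow> nat \<Rightarrow> complex mat" where
  "mp_coeff P i = map_mat (\<lambda>p. poly.coeff p i) P"

definition mp_eval :: "complex poly mat \<Rightarrow> complex \<Rightarrow> complex mat" where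
  "mp_eval P z = map_mat (\<lambda>p. poly p z) P"

definition mp_deriv :: "complex poly mat \<Rightarrow> complex poly mat" where
  "mp_deriv P = map_mat pderiv P"

definition mp_grade :: "nat \<Rightarrow> complex poly mat \<Rightarrow> bool" where
  "mp_grade d P \<longleftrightarrow> (\<forall>i > d. mp_coeff P i = 0\<^sub>m (dim_row P) (dim_col P))"

definition mp_degree :: "nat \<Rightarrow> complex poly mat \<Rightarrow> bool" where
  "mp_degree d P \<longleftrightarrow> mp_grade d P \<and> mp_coeff P d \<noteq> 0\<^sub>m (dim_row P) (dim_col P)"

definition mp_regular :: "complex poly mat \<Rightarrow> bool" where
  "mp_regular P \<longleftrightarrow> det P \<noteq> 0"

(* algebraic multiplicity one; Polynomial.order p z is unspecified for p = 0 *)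
definition mp_simple_eigenvalue :: "complex poly mat \<Rightarrow> complex \<Rightarrow> bool" where
  "mp_simple_eigenvalue P z \<longleftrightarrow> det P \<noteq> 0 \<and> Polynomial.order z (det P) = 1"

definition mp_right_eigenvector :: "complex poly mat \<Rightarrow> complex \<Rightarrow> complex vec \<Rightarrow> bool" where
  "mp_right_eigenvector P z x \<longleftrightarrow>
     x \<in> carrier_vec (dim_col P) \<and> x \<noteq> 0\<^sub>v (dim_col P) \<and>
     mp_eval P z *\<^sub>v x = 0\<^sub>v (dim_row P)"

definition mp_left_eigenvector :: "complex poly mat \<Rightarrow> complex \<Rightarrow> complex vec \<Rightarrow> bool" where
  "mp_left_eigenvector P z y \<longleftrightarrow>
     y \<in> carrier_vec (dim_row P) \<and> y \<noteq> 0\<^sub>v (dim_row P) \<and>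
     mat_of_rows (dim_row P) [conjugate y] * mp_eval P z = 0\<^sub>m 1 (dim_col P)"

section \<open>Condition numbers\<close>

text \<open>The parameter \<open>d\<close> is the grade of \<open>P\<close>; \<open>x\<close> and \<open>y\<close> are a right and a left
  eigenvector for the eigenvalue \<open>z\<close>.\<close>

definition coeff_cond ::
  "nat \<Rightarrow> complex poly mat \<Rightarrow> complex \<Rightarrow> complex vec \<Rightarrow> complex vec \<Rightarrow> real" where
  "coeff_cond d P z x y =
     (\<Sum>i\<le>d. cmod z ^ i * spectral_norm (mp_coeff P i)) * l2_norm x * l2_norm y
     / (cmod z * cmod (conjugate y \<bullet> (mp_eval (mp_deriv P) z *\<^sub>v x)))"

(* the block row [A_0 ... A_d] of the coefficients of P *)
definition coeff_row :: "nat \<Rightarrow> complex poly mat \<Rightarrow> complex mat" where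
  "coeff_row d P = mat (dim_row P) ((d + 1) * dim_col P)
     (\<lambda>(i,j). mp_coeff P (j div dim_col P) $$ (i, j mod dim_col P))"

definition norm_cond ::
  "nat \<Rightarrow> complex poly mat \<Rightarrow> complex \<Rightarrow> complex vec \<Rightarrow> complex vec \<Rightarrow> real" where
  "norm_cond d P z x y =
     spectral_norm (coeff_row d P) * (\<Sum>i\<le>d. cmod z ^ i) * l2_norm x * l2_norm y
     / (cmod z * cmod (conjugate y \<bullet> (mp_eval (mp_deriv P) z *\<^sub>v x)))"

section \<open>Block Kronecker companion forms\<close>

definition kronecker :: "'a::semiring_1 mat \<Rightarrow> 'a mat \<Rightarrow> 'a mat" where
  "kronecker A B = mat (dim_row A * dim_row B) (dim_col A * dim_col B)
     (\<lambda>(i,j). A $$ (i div dim_row B, j div dim_col B) * B $$ (i mod dim_row B, j mod dim_col B))"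

text \<open>\<open>L_mat k q\<close> and \<open>Lambda_mat k q\<close> are $L_k(q)$ and $\Lambda_k(q)$ for a ring element
  \<open>q\<close>; below, \<open>q = monom 1 l\<close> is the polynomial $\lambda^l$. For \<open>k = 0\<close> the former is the
  empty matrix with no rows and one column, so that the corresponding blocks of the
  \<open>four_block_mat\<close> below have no rows (columns).\<close>

definition L_mat :: "nat \<Rightarrow> 'a::comm_ring_1 \<Rightarrow> 'a mat" where
  "L_mat k q = mat k (k + 1) (\<lambda>(i,j). if j = i then - 1 else if j = i + 1 then q else 0)"

definition Lambda_mat :: "nat \<Rightarrow> 'a::comm_ring_1 \<Rightarrow> 'a mat" where
  "Lambda_mat k q = mat (k + 1) 1 (\<lambda>(i,j). q ^ (k - i))"

definition block_kronecker_form ::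
  "nat \<Rightarrow> nat \<Rightarrow> nat \<Rightarrow> nat \<Rightarrow> complex poly mat \<Rightarrow> complex poly mat" where
  "block_kronecker_form \<epsilon> n \<eta> l M =
     four_block_mat
       M                                                     (kronecker (L_mat \<eta> (monom 1 l))\<^sup>T (1\<^sub>m n))
       (kronecker (L_mat \<epsilon> (monom 1 l)) (1\<^sub>m n))              (0\<^sub>m (\<epsilon> * n) (\<eta> * n))"

definition block_kronecker_condition ::
  "nat \<Rightarrow> nat \<Rightarrow> nat \<Rightarrow> nat \<Rightarrow> complex poly mat \<Rightarrow> complex poly mat \<Rightarrow> bool" where
  "block_kronecker_condition \<epsilon> n \<eta> l M P \<longleftrightarrow>
     M \<in> carrier_mat ((\<eta> + 1) * n) ((\<epsilon> + 1) * n) \<and> mp_grade l M \<and>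
     kronecker (Lambda_mat \<eta> (monom 1 l))\<^sup>T (1\<^sub>m n) * M * kronecker (Lambda_mat \<epsilon> (monom 1 l)) (1\<^sub>m n) = P"

definition mat_block :: "nat \<Rightarrow> 'a mat \<Rightarrow> nat \<Rightarrow> nat \<Rightarrow> 'a mat" where
  "mat_block n B i j = mat n n (\<lambda>(a,b). B $$ (i * n + a, j * n + b))"

definition block_kronecker_companion_form ::
  "nat \<Rightarrow> nat \<Rightarrow> nat \<Rightarrow> complex poly mat \<Rightarrow> complex poly mat \<Rightarrow> bool" where
  "block_kronecker_companion_form n d l P L \<longleftrightarrow>
     l dvd d \<and>
     (\<exists>\<epsilon> \<eta> M. \<epsilon> + \<eta> + 1 = d div l \<and>
        block_kronecker_condition \<epsilon> n \<eta> l M P \<and>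
        L = block_kronecker_form \<epsilon> n \<eta> l M \<and>
        (\<forall>t\<le>l. \<forall>i\<le>\<eta>. \<forall>j\<le>\<epsilon>.
           mat_block n (mp_coeff M t) i j \<in> {0\<^sub>m n n, 1\<^sub>m n} \<union> mp_coeff P ` {0..d}))"

end

theory Submission
  imports Defs "HOL-Analysis.L2_Norm"
begin

text \<open>A right null vector of \<open>L(z)\<close> has the form \<open>(\<Lambda>\<^sub>\<epsilon>(z\<^sup>l) \<otimes> v, s)\<close> with \<open>P(z) v = 0\<close>. Its lower part \<open>s\<close>
  solves a two-term recurrence driven by \<open>M(z)(\<Lambda>\<^sub>\<epsilon>(z\<^sup>l) \<otimes> v)\<close>; running it from the first block if
  \<open>|z| \<le> 1\<close> and from the last block otherwise shows that the whole vector has norm at most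
  \<open>K \<mu>\<^bsup>l\<epsilon>\<^esup> \<parallel>v\<parallel>\<close>, where \<open>\<mu> = max 1 |z|\<close> and \<open>K\<close> depends only on \<open>d\<close>. Left null vectors are handled by
  transposition and contribute \<open>\<mu>\<^bsup>l\<eta>\<^esup>\<close>. The coefficients of \<open>L\<close> have bounded norm and contribute
  \<open>\<mu>\<^sup>l\<close>, so the numerator of the condition number of \<open>L\<close> is \<open>O(\<mu>\<^sup>d)\<close>, because
  \<open>l (\<epsilon> + \<eta> + 1) = d\<close>; both normalisations make the numerator for \<open>P\<close> at least \<open>\<mu>\<^sup>d\<close>. The
  denominators agree: \<open>y\<^sup>* L'(z) x = w\<^sup>* P'(z) v\<close>, and \<open>v\<close>, \<open>w\<close> are multiples of the given
  eigenvectors of \<open>P\<close> since the kernel of \<open>P(z)\<close> is one-dimensional.\<close>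

section \<open>The Euclidean norm\<close>

lemma l2_norm_L2_set: "l2_norm v = L2_set (\<lambda>i. cmod (v $ i)) {..<dim_vec v}"
  by (simp add: l2_norm_def L2_set_def)

lemma l2_norm_vec: "l2_norm (vec n f) = L2_set (\<lambda>i. cmod (f i)) {..<n}"
  by (simp add: l2_norm_L2_set cong: L2_set_cong_simp)

lemma l2_norm_nonneg [simp]: "0 \<le> l2_norm v"
  by (simp add: l2_norm_L2_set)

lemma l2_norm_zero [simp]: "l2_norm (0\<^sub>v n) = 0"
  by (simp add: l2_norm_def)

lemma l2_norm_eq_0_iff: "v \<in> carrier_vec n \<Longrightarrow> l2_norm v = 0 \<longleftrightarrow> v = 0\<^sub>v n"
  by (auto simp: l2_norm_L2_set L2_set_eq_0_iff)

lemma l2_norm_smult: "l2_norm (c \<cdot>\<^sub>v v) = cmod c * l2_norm v"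
proof -
  have "l2_norm (c \<cdot>\<^sub>v v) = L2_set (\<lambda>i. cmod c * cmod (v $ i)) {..<dim_vec v}"
    unfolding l2_norm_L2_set by (intro L2_set_cong) (auto simp: norm_mult)
  then show ?thesis
    by (simp add: l2_norm_L2_set L2_set_right_distrib)
qed

lemma l2_norm_conjugate [simp]: "l2_norm (conjugate v) = l2_norm (v :: complex vec)"
  unfolding l2_norm_L2_set by (intro L2_set_cong) (auto simp: conjugate_complex_def)

lemma L2_set_cmod_sum:
  assumes "finite T"
  shows "L2_set (\<lambda>i. cmod (\<Sum>t\<in>T. f t i)) A \<le> (\<Sum>t\<in>T. L2_set (\<lambda>i. cmod (f t i)) A)"
  using assms
proof (induction T rule: finite_induct)
  case empty
  show ?case by (simp add: L2_set_def)
next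
  case (insert t T)
  have "L2_set (\<lambda>i. cmod (\<Sum>t\<in>insert t T. f t i)) A
      \<le> L2_set (\<lambda>i. cmod (f t i) + cmod (\<Sum>t\<in>T. f t i)) A"
    using insert by (intro L2_set_mono) (auto intro: norm_triangle_ineq)
  also have "\<dots> \<le> L2_set (\<lambda>i. cmod (f t i)) A + L2_set (\<lambda>i. cmod (\<Sum>t\<in>T. f t i)) A"
    by (rule L2_set_triangle_ineq)
  finally show ?case using insert by simp
qed

lemma l2_norm_add:
  assumes "u \<in> carrier_vec n" "v \<in> carrier_vec n"
  shows "l2_norm (u + v) \<le> l2_norm u + l2_norm v"
proof -
  have "l2_norm (u + v) \<le> L2_set (\<lambda>i. cmod (u $ i) + cmod (v $ i)) {..<n}"
    unfolding l2_norm_L2_set using assms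
    by (auto intro!: L2_set_mono norm_triangle_ineq)
  also have "\<dots> \<le> l2_norm u + l2_norm v"
    unfolding l2_norm_L2_set using assms L2_set_triangle_ineq by auto
  finally show ?thesis .
qed

lemma cmod_scalar_prod_le:
  assumes "u \<in> carrier_vec n" "v \<in> carrier_vec n"
  shows "cmod (u \<bullet> v) \<le> l2_norm u * l2_norm v"
proof -
  have "cmod (u \<bullet> v) \<le> (\<Sum>i<n. \<bar>cmod (u $ i)\<bar> * \<bar>cmod (v $ i)\<bar>)"
    unfolding scalar_prod_def using assms
    by (auto intro!: sum_norm_le simp: norm_mult lessThan_atLeast0)
  also have "\<dots> \<le> l2_norm u * l2_norm v"
    using assms L2_set_mult_ineq[of "\<lambda>i. cmod (u $ i)" "\<lambda>i. cmod (v $ i)" "{..<n}"]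
    by (simp add: l2_norm_L2_set)
  finally show ?thesis .
qed

lemma scalar_prod_conjugate_self:
  "v \<bullet> conjugate v = complex_of_real ((l2_norm v)\<^sup>2)"
  by (simp add: scalar_prod_def l2_norm_def conjugate_complex_def sum_nonneg
      lessThan_atLeast0 of_real_power flip: complex_norm_square)

lemma l2_norm_append:
  "l2_norm (u @\<^sub>v v) = sqrt ((l2_norm u)\<^sup>2 + (l2_norm v)\<^sup>2)"
proof -
  have split: "(\<Sum>i<m + k. f i) = (\<Sum>i<m. f i) + (\<Sum>i<k. f (m + i))"
    for f :: "nat \<Rightarrow> real" and m k
    by (induction k) (auto simp: add.assoc)
  have "(\<Sum>i<dim_vec u + dim_vec v. (cmod ((u @\<^sub>v v) $ i))\<^sup>2)
      = (\<Sum>i<dim_vec u. (cmod (u $ i))\<^sup>2) + (\<Sum>i<dim_vec v. (cmod (v $ i))\<^sup>2)"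
    by (simp add: split)
  then show ?thesis
    by (simp add: l2_norm_def sum_nonneg)
qed

lemma l2_norm_append_le: "l2_norm (u @\<^sub>v v) \<le> l2_norm u + l2_norm v"
  unfolding l2_norm_append by (rule sqrt_sum_squares_le_sum) auto

lemma l2_norm_le_append:
  "l2_norm u \<le> l2_norm (u @\<^sub>v v)" "l2_norm v \<le> l2_norm (u @\<^sub>v v)"
  unfolding l2_norm_append by (auto intro: real_le_rsqrt)

section \<open>Block vectors\<close>

definition vec_block :: "nat \<Rightarrow> 'a vec \<Rightarrow> nat \<Rightarrow> 'a vec" where
  "vec_block n u i = vec n (\<lambda>a. u $ (i * n + a))"

lemma vec_block_carrier [simp]: "vec_block n u i \<in> carrier_vec n"
  by (simp add: vec_block_def)

lemma block_index_less:
  fixes i a k n :: nat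
  assumes "i < k" "a < n"
  shows "i * n + a < k * n"
proof -
  have "i * n + a < Suc i * n" using assms by simp
  also have "\<dots> \<le> k * n" using assms by (intro mult_le_mono1) simp
  finally show ?thesis .
qed

lemma block_index_exhaust:
  fixes j k n :: nat
  assumes "j < k * n"
  obtains i a where "j = i * n + a" "i < k" "a < n"
proof
  show "j = (j div n) * n + j mod n" by simp
  show "j div n < k" using assms by (simp add: less_mult_imp_div_less)
  show "j mod n < n" using assms by (cases n) auto
qed

lemma sum_block:
  fixes f :: "nat \<Rightarrow> 'a::comm_monoid_add"
  shows "(\<Sum>j<k * n. f j) = (\<Sum>i<k. \<Sum>a<n. f (i * n + a))"
proof -
  have "(\<Sum>j\<in>{i * n..<i * n + n}. f j) = (\<Sum>a<n. f (i * n + a))" for i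
    using sum.shift_bounds_nat_ivl[of f 0 "i * n" n]
    by (simp add: lessThan_atLeast0 add.commute)
  then show ?thesis
    by (simp flip: sum.nat_group)
qed

lemma l2_norm_blocks:
  assumes "u \<in> carrier_vec (k * n)"
  shows "l2_norm u = L2_set (\<lambda>i. l2_norm (vec_block n u i)) {..<k}"
proof -
  have "(\<Sum>j<k * n. (cmod (u $ j))\<^sup>2) = (\<Sum>i<k. (l2_norm (vec_block n u i))\<^sup>2)"
    unfolding sum_block by (simp add: l2_norm_def vec_block_def sum_nonneg)
  then show ?thesis
    using assms by (simp add: l2_norm_def[of u] L2_set_def)
qed

lemma l2_norm_le_sum_blocks:
  assumes "u \<in> carrier_vec (k * n)"
  shows "l2_norm u \<le> (\<Sum>i<k. l2_norm (vec_block n u i))"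
  unfolding l2_norm_blocks[OF assms] by (rule L2_set_le_sum) simp

lemma l2_norm_block_le:
  assumes "u \<in> carrier_vec (k * n)" "i < k"
  shows "l2_norm (vec_block n u i) \<le> l2_norm u"
  unfolding l2_norm_blocks[OF assms(1)]
  using assms(2) member_le_L2_set[of "{..<k}" i "\<lambda>i. l2_norm (vec_block n u i)"] by simp

section \<open>The spectral norm\<close>

lemma spectral_norm_bdd_above:
  "bdd_above ((\<lambda>v. l2_norm (A *\<^sub>v v)) ` {v \<in> carrier_vec (dim_col A). l2_norm v \<le> 1})"
proof (rule bdd_aboveI2)
  fix v assume v: "v \<in> {v \<in> carrier_vec (dim_col A). l2_norm v \<le> 1}"
  have "l2_norm (A *\<^sub>v v) \<le> (\<Sum>i<dim_row A. cmod ((A *\<^sub>v v) $ i))"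
    unfolding l2_norm_L2_set dim_mult_mat_vec by (rule L2_set_le_sum) simp
  also have "\<dots> \<le> (\<Sum>i<dim_row A. l2_norm (row A i))"
  proof (intro sum_mono)
    fix i assume i: "i \<in> {..<dim_row A}"
    have "cmod ((A *\<^sub>v v) $ i) \<le> l2_norm (row A i) * l2_norm v"
      using v i cmod_scalar_prod_le[of "row A i" "dim_col A" v] by simp
    also have "\<dots> \<le> l2_norm (row A i)" using v by (simp add: mult_left_le)
    finally show "cmod ((A *\<^sub>v v) $ i) \<le> l2_norm (row A i)" .
  qed
  finally show "l2_norm (A *\<^sub>v v) \<le> (\<Sum>i<dim_row A. l2_norm (row A i))" .
qed

lemma l2_norm_mult_mat_vec_le:
  assumes "v \<in> carrier_vec (dim_col A)"
  shows "l2_norm (A *\<^sub>v v) \<le> spectral_norm A * l2_norm v"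
proof (cases "l2_norm v = 0")
  case True
  then have "v = 0\<^sub>v (dim_col A)" using assms l2_norm_eq_0_iff by blast
  then show ?thesis by (simp add: l2_norm_L2_set L2_set_def)
next
  case False
  define c where "c = complex_of_real (1 / l2_norm v)"
  have c: "cmod c * l2_norm v = 1" using False by (simp add: c_def norm_divide)
  have "l2_norm (A *\<^sub>v (c \<cdot>\<^sub>v v)) \<le> spectral_norm A"
    unfolding spectral_norm_def using assms c
    by (intro cSUP_upper spectral_norm_bdd_above) (auto simp: l2_norm_smult)
  moreover have "A *\<^sub>v (c \<cdot>\<^sub>v v) = c \<cdot>\<^sub>v (A *\<^sub>v v)"
    using assms by (intro mult_mat_vec) auto
  ultimately have "cmod c * l2_norm (A *\<^sub>v v) \<le> spectral_norm A"
    by (simp add: l2_norm_smult)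
  then have "cmod c * l2_norm (A *\<^sub>v v) * l2_norm v \<le> spectral_norm A * l2_norm v"
    by (rule mult_right_mono) simp
  also have "cmod c * l2_norm (A *\<^sub>v v) * l2_norm v = cmod c * l2_norm v * l2_norm (A *\<^sub>v v)"
    by simp
  finally show ?thesis using c by simp
qed

lemma spectral_norm_le:
  assumes "\<And>v. v \<in> carrier_vec (dim_col A) \<Longrightarrow> l2_norm (A *\<^sub>v v) \<le> c * l2_norm v" "0 \<le> c"
  shows "spectral_norm A \<le> c"
  unfolding spectral_norm_def
proof (rule cSUP_least)
  have "0\<^sub>v (dim_col A) \<in> {v \<in> carrier_vec (dim_col A). l2_norm v \<le> 1}" by simp
  then show "{v \<in> carrier_vec (dim_col A). l2_norm v \<le> 1} \<noteq> {}" by blast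
next
  fix v assume v: "v \<in> {v \<in> carrier_vec (dim_col A). l2_norm v \<le> 1}"
  then have "l2_norm (A *\<^sub>v v) \<le> c * l2_norm v" using assms(1) by simp
  also have "\<dots> \<le> c" using v assms(2) by (simp add: mult_left_le)
  finally show "l2_norm (A *\<^sub>v v) \<le> c" .
qed

lemma spectral_norm_nonneg [simp]: "0 \<le> spectral_norm A"
proof -
  have "l2_norm (A *\<^sub>v 0\<^sub>v (dim_col A)) \<le> spectral_norm A"
    unfolding spectral_norm_def by (intro cSUP_upper spectral_norm_bdd_above) auto
  then show ?thesis using l2_norm_nonneg order_trans by blast
qed

lemma spectral_norm_zero [simp]: "spectral_norm (0\<^sub>m r c) = 0"
proof (rule antisym[OF spectral_norm_le])
  fix v :: "complex vec" assume "v \<in> carrier_vec (dim_col (0\<^sub>m r c :: complex mat))"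
  then have "0\<^sub>m r c *\<^sub>v v = 0\<^sub>v r" by auto
  then show "l2_norm (0\<^sub>m r c *\<^sub>v v) \<le> 0 * l2_norm v" by simp
qed auto

lemma spectral_norm_smult_one: "spectral_norm (c \<cdot>\<^sub>m 1\<^sub>m n) \<le> cmod c"
proof (rule spectral_norm_le)
  fix v :: "complex vec" assume "v \<in> carrier_vec (dim_col (c \<cdot>\<^sub>m 1\<^sub>m n))"
  then have "(c \<cdot>\<^sub>m 1\<^sub>m n) *\<^sub>v v = c \<cdot>\<^sub>v v"
    by (intro eq_vecI) (auto simp: row_smult)
  then show "l2_norm ((c \<cdot>\<^sub>m 1\<^sub>m n) *\<^sub>v v) \<le> cmod c * l2_norm v"
    by (simp add: l2_norm_smult)
qed simp

lemma spectral_norm_transpose_le: "spectral_norm A\<^sup>T \<le> spectral_norm A"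
proof (rule spectral_norm_le)
  fix u :: "complex vec" assume "u \<in> carrier_vec (dim_col A\<^sup>T)"
  then have u: "u \<in> carrier_vec (dim_row A)" by simp
  define w where "w = A\<^sup>T *\<^sub>v u"
  have w: "w \<in> carrier_vec (dim_col A)" unfolding w_def by (intro carrier_vecI) simp
  have "w \<bullet> conjugate w = u \<bullet> (A *\<^sub>v conjugate w)"
    using transpose_vec_mult_scalar[of A "dim_row A" "dim_col A" "conjugate w" u] u w
    by (auto simp: w_def)
  then have "(l2_norm w)\<^sup>2 = cmod (u \<bullet> (A *\<^sub>v conjugate w))"
    using scalar_prod_conjugate_self[of w] by (metis abs_power2 norm_of_real)
  also have "\<dots> \<le> l2_norm u * l2_norm (A *\<^sub>v conjugate w)"
    using u by (intro cmod_scalar_prod_le[of _ "dim_row A"] carrier_vecI) auto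
  also have "\<dots> \<le> l2_norm u * (spectral_norm A * l2_norm w)"
    using w l2_norm_mult_mat_vec_le[of "conjugate w" A]
    by (intro mult_left_mono) auto
  finally have "l2_norm w * l2_norm w \<le> (spectral_norm A * l2_norm u) * l2_norm w"
    by (simp add: power2_eq_square mult_ac)
  then have "l2_norm w \<le> spectral_norm A * l2_norm u"
    by (smt (verit) l2_norm_nonneg mult_le_cancel_right mult_nonneg_nonneg spectral_norm_nonneg)
  then show "l2_norm (A\<^sup>T *\<^sub>v u) \<le> spectral_norm A * l2_norm u" by (simp add: w_def)
qed simp

lemma spectral_norm_transpose [simp]: "spectral_norm A\<^sup>T = spectral_norm A"
  using spectral_norm_transpose_le[of A] spectral_norm_transpose_le[of "A\<^sup>T"] by simp

lemma mult_mat_vec_index_sum: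
  "i < dim_row A \<Longrightarrow> v \<in> carrier_vec (dim_col A) \<Longrightarrow>
    (A *\<^sub>v v) $ i = (\<Sum>j<dim_col A. A $$ (i, j) * v $ j)"
  by (simp add: scalar_prod_def lessThan_atLeast0)

lemma spectral_norm_le_sum_blocks:
  assumes "B \<in> carrier_mat (p * n) (q * n)"
  shows "spectral_norm B \<le> (\<Sum>i<p. \<Sum>j<q. spectral_norm (mat_block n B i j))"
proof (rule spectral_norm_le)
  fix v :: "complex vec" assume "v \<in> carrier_vec (dim_col B)"
  then have v: "v \<in> carrier_vec (q * n)" using assms by auto
  have "l2_norm (B *\<^sub>v v) \<le> (\<Sum>i<p. l2_norm (vec_block n (B *\<^sub>v v) i))"
    by (intro l2_norm_le_sum_blocks mult_mat_vec_carrier[OF assms v])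
  also have "\<dots> \<le> (\<Sum>i<p. \<Sum>j<q. spectral_norm (mat_block n B i j) * l2_norm v)"
  proof (intro sum_mono)
    fix i assume i: "i \<in> {..<p}"
    have "vec_block n (B *\<^sub>v v) i
        = vec n (\<lambda>a. \<Sum>j<q. (mat_block n B i j *\<^sub>v vec_block n v j) $ a)"
      using i assms v
      by (auto simp: vec_block_def mult_mat_vec_index_sum block_index_less sum_block mat_block_def
          simp del: index_mult_mat_vec)
    then have "l2_norm (vec_block n (B *\<^sub>v v) i)
        \<le> (\<Sum>j<q. L2_set (\<lambda>a. cmod ((mat_block n B i j *\<^sub>v vec_block n v j) $ a)) {..<n})"
      by (simp add: l2_norm_vec L2_set_cmod_sum del: index_mult_mat_vec)
    also have "\<dots> = (\<Sum>j<q. l2_norm (mat_block n B i j *\<^sub>v vec_block n v j))"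
      by (simp add: l2_norm_L2_set mat_block_def del: index_mult_mat_vec)
    also have "\<dots> \<le> (\<Sum>j<q. spectral_norm (mat_block n B i j) * l2_norm v)"
    proof (intro sum_mono)
      fix j assume j: "j \<in> {..<q}"
      have "l2_norm (mat_block n B i j *\<^sub>v vec_block n v j)
          \<le> spectral_norm (mat_block n B i j) * l2_norm (vec_block n v j)"
        by (rule l2_norm_mult_mat_vec_le) (simp add: mat_block_def)
      also have "\<dots> \<le> spectral_norm (mat_block n B i j) * l2_norm v"
        using j v by (intro mult_left_mono l2_norm_block_le) auto
      finally show "l2_norm (mat_block n B i j *\<^sub>v vec_block n v j)
          \<le> spectral_norm (mat_block n B i j) * l2_norm v" .
    qed
    finally show "l2_norm (vec_block n (B *\<^sub>v v) i)
        \<le> (\<Sum>j<q. spectral_norm (mat_block n B i j) * l2_norm v)" .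
  qed
  also have "\<dots> = (\<Sum>i<p. \<Sum>j<q. spectral_norm (mat_block n B i j)) * l2_norm v"
    by (simp add: sum_distrib_right)
  finally show "l2_norm (B *\<^sub>v v)
      \<le> (\<Sum>i<p. \<Sum>j<q. spectral_norm (mat_block n B i j)) * l2_norm v" .
qed (simp add: sum_nonneg)

lemma spectral_norm_four_block_le:
  fixes A B C D :: "complex mat"
  assumes A: "A \<in> carrier_mat r1 c1" and B: "B \<in> carrier_mat r1 c2"
    and C: "C \<in> carrier_mat r2 c1" and D: "D \<in> carrier_mat r2 c2"
  shows "spectral_norm (four_block_mat A B C D)
    \<le> spectral_norm A + spectral_norm B + spectral_norm C + spectral_norm D"
proof (rule spectral_norm_le)
  fix v :: "complex vec" assume "v \<in> carrier_vec (dim_col (four_block_mat A B C D))"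
  then have v: "v \<in> carrier_vec (c1 + c2)" using A D by simp
  define a where "a = vec_first v c1"
  define b where "b = vec_last v c2"
  have ab: "a \<in> carrier_vec c1" "b \<in> carrier_vec c2" "v = a @\<^sub>v b"
    using v by (auto simp: a_def b_def)
  have le: "l2_norm (X *\<^sub>v u) \<le> spectral_norm X * l2_norm v"
    if "u \<in> carrier_vec (dim_col X)" "l2_norm u \<le> l2_norm v" for X u
    using l2_norm_mult_mat_vec_le[OF that(1)]
      mult_left_mono[OF that(2) spectral_norm_nonneg[of X]] by simp
  have n: "l2_norm a \<le> l2_norm v" "l2_norm b \<le> l2_norm v"
    using ab l2_norm_le_append by auto
  have "l2_norm (four_block_mat A B C D *\<^sub>v v)
      \<le> l2_norm (A *\<^sub>v a + B *\<^sub>v b) + l2_norm (C *\<^sub>v a + D *\<^sub>v b)"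
    unfolding ab(3) four_block_mat_mult_vec[OF assms ab(1,2)] by (rule l2_norm_append_le)
  also have "l2_norm (A *\<^sub>v a + B *\<^sub>v b) \<le> l2_norm (A *\<^sub>v a) + l2_norm (B *\<^sub>v b)"
    using A B ab by (intro l2_norm_add[of _ r1] mult_mat_vec_carrier)
  also have "l2_norm (C *\<^sub>v a + D *\<^sub>v b) \<le> l2_norm (C *\<^sub>v a) + l2_norm (D *\<^sub>v b)"
    using C D ab by (intro l2_norm_add[of _ r2] mult_mat_vec_carrier)
  finally show "l2_norm (four_block_mat A B C D *\<^sub>v v)
      \<le> (spectral_norm A + spectral_norm B + spectral_norm C + spectral_norm D) * l2_norm v"
    using le[of a A] le[of b B] le[of a C] le[of b D] n ab(1,2) A B C D
    unfolding distrib_right by fastforce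
qed simp

section \<open>Block Kronecker matrices\<close>

lemma kronecker_one_carrier [simp]:
  "A \<in> carrier_mat r c \<Longrightarrow> kronecker A (1\<^sub>m n) \<in> carrier_mat (r * n) (c * n)"
  by (auto simp: kronecker_def)

lemma kronecker_one_index:
  fixes A :: "'a::semiring_1 mat"
  assumes "i < dim_row A" "j < dim_col A" "a < n" "b < n"
  shows "kronecker A (1\<^sub>m n) $$ (i * n + a, j * n + b) = (if a = b then A $$ (i, j) else 0)"
  using assms by (auto simp: kronecker_def block_index_less)

lemma kronecker_one_transpose:
  fixes A :: "'a::semiring_1 mat"
  shows "(kronecker A (1\<^sub>m n))\<^sup>T = kronecker A\<^sup>T (1\<^sub>m n)"
proof (rule eq_matI)
  fix i j assume "i < dim_row (kronecker A\<^sup>T (1\<^sub>m n))" "j < dim_col (kronecker A\<^sup>T (1\<^sub>m n))"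
  then have "i < dim_col A * n" "j < dim_row A * n" by (auto simp: kronecker_def)
  then obtain i' a j' b where "i = i' * n + a" "i' < dim_col A" "a < n"
    "j = j' * n + b" "j' < dim_row A" "b < n"
    by (metis block_index_exhaust)
  moreover from this have "i < dim_col (kronecker A (1\<^sub>m n))" "j < dim_row (kronecker A (1\<^sub>m n))"
    by (auto simp: kronecker_def block_index_less)
  ultimately show "(kronecker A (1\<^sub>m n))\<^sup>T $$ (i, j) = kronecker A\<^sup>T (1\<^sub>m n) $$ (i, j)"
    by (simp add: kronecker_one_index)
qed (auto simp: kronecker_def)

lemma kronecker_one_mult_vec_index:
  fixes A :: "'a::comm_ring_1 mat"
  assumes "A \<in> carrier_mat r c" "u \<in> carrier_vec (c * n)" "i < r" "a < n"
  shows "(kronecker A (1\<^sub>m n) *\<^sub>v u) $ (i * n + a) = (\<Sum>j<c. A $$ (i, j) * u $ (j * n + a))"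
proof -
  have "(kronecker A (1\<^sub>m n) *\<^sub>v u) $ (i * n + a)
      = (\<Sum>k<c * n. kronecker A (1\<^sub>m n) $$ (i * n + a, k) * u $ k)"
    using assms mult_mat_vec_index_sum[of "i * n + a" "kronecker A (1\<^sub>m n)" u]
    by (simp add: kronecker_def block_index_less del: index_mult_mat_vec)
  also have "\<dots> = (\<Sum>j<c. \<Sum>b<n. (if a = b then A $$ (i, j) else 0) * u $ (j * n + b))"
    unfolding sum_block using assms by (intro sum.cong refl) (auto simp: kronecker_one_index)
  also have "\<dots> = (\<Sum>j<c. A $$ (i, j) * u $ (j * n + a))"
  proof (intro sum.cong refl)
    fix j
    have "(\<Sum>b<n. (if a = b then A $$ (i, j) else 0) * u $ (j * n + b))
        = (\<Sum>b<n. if a = b then A $$ (i, j) * u $ (j * n + b) else 0)"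
      by (intro sum.cong) auto
    also have "\<dots> = A $$ (i, j) * u $ (j * n + a)" using assms(4) by simp
    finally show "(\<Sum>b<n. (if a = b then A $$ (i, j) else 0) * u $ (j * n + b))
        = A $$ (i, j) * u $ (j * n + a)" .
  qed
  finally show ?thesis .
qed

lemma kronecker_one_mult_vec_mult:
  fixes A B :: "'a::comm_ring_1 mat"
  assumes A: "A \<in> carrier_mat r m" and B: "B \<in> carrier_mat m c" and u: "u \<in> carrier_vec (c * n)"
  shows "kronecker A (1\<^sub>m n) *\<^sub>v (kronecker B (1\<^sub>m n) *\<^sub>v u) = kronecker (A * B) (1\<^sub>m n) *\<^sub>v u"
proof (rule eq_vecI)
  have AB: "A * B \<in> carrier_mat r c" using A B by simp
  have Bu: "kronecker B (1\<^sub>m n) *\<^sub>v u \<in> carrier_vec (m * n)"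
    using kronecker_one_carrier[OF B] u by (rule mult_mat_vec_carrier)
  show "dim_vec (kronecker A (1\<^sub>m n) *\<^sub>v (kronecker B (1\<^sub>m n) *\<^sub>v u))
      = dim_vec (kronecker (A * B) (1\<^sub>m n) *\<^sub>v u)"
    by (simp add: kronecker_def)
  fix k assume "k < dim_vec (kronecker (A * B) (1\<^sub>m n) *\<^sub>v u)"
  then have "k < r * n" using A by (simp add: kronecker_def)
  then obtain i a where k: "k = i * n + a" "i < r" "a < n" by (rule block_index_exhaust)
  have "(kronecker A (1\<^sub>m n) *\<^sub>v (kronecker B (1\<^sub>m n) *\<^sub>v u)) $ k
      = (\<Sum>j<m. A $$ (i, j) * (\<Sum>h<c. B $$ (j, h) * u $ (h * n + a)))"
    unfolding k(1) kronecker_one_mult_vec_index[OF A Bu k(2,3)]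
    using kronecker_one_mult_vec_index[OF B u _ k(3)] by simp
  also have "\<dots> = (\<Sum>h<c. (\<Sum>j<m. A $$ (i, j) * B $$ (j, h)) * u $ (h * n + a))"
    unfolding sum_distrib_left sum_distrib_right
    by (subst sum.swap) (simp add: mult.assoc)
  also have "\<dots> = (\<Sum>h<c. (A * B) $$ (i, h) * u $ (h * n + a))"
    using A B k(2) by (intro sum.cong) (auto simp: scalar_prod_def lessThan_atLeast0)
  also have "\<dots> = (kronecker (A * B) (1\<^sub>m n) *\<^sub>v u) $ k"
    unfolding k(1) kronecker_one_mult_vec_index[OF AB u k(2,3)] ..
  finally show "(kronecker A (1\<^sub>m n) *\<^sub>v (kronecker B (1\<^sub>m n) *\<^sub>v u)) $ k
      = (kronecker (A * B) (1\<^sub>m n) *\<^sub>v u) $ k" .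
qed

lemma kronecker_zero_mult_vec:
  fixes u :: "'a::comm_ring_1 vec"
  assumes "u \<in> carrier_vec (c * n)"
  shows "kronecker (0\<^sub>m r c) (1\<^sub>m n) *\<^sub>v u = 0\<^sub>v (r * n)"
proof -
  have "kronecker (0\<^sub>m r c) (1\<^sub>m n) = (0\<^sub>m (r * n) (c * n) :: 'a mat)"
    by (rule eq_matI) (auto simp: kronecker_def less_mult_imp_div_less)
  then show ?thesis using assms by auto
qed

lemma L_mat_carrier [simp]: "L_mat k q \<in> carrier_mat k (k + 1)"
  by (simp add: L_mat_def)

lemma Lambda_mat_carrier [simp]: "Lambda_mat k q \<in> carrier_mat (k + 1) 1"
  by (simp add: Lambda_mat_def)

lemma L_mat_row_sum:
  fixes q :: "'a::comm_ring_1"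
  assumes "i < k"
  shows "(\<Sum>j<k + 1. L_mat k q $$ (i, j) * f j) = q * f (Suc i) - f i"
proof -
  have "(\<Sum>j<k + 1. L_mat k q $$ (i, j) * f j)
      = (\<Sum>j<k + 1. (if j = Suc i then q * f j else 0) - (if j = i then f j else 0))"
    using assms by (intro sum.cong) (auto simp: L_mat_def)
  also have "\<dots> = q * f (Suc i) - f i"
    using assms by (simp add: sum_subtractf)
  finally show ?thesis .
qed

lemma L_mat_col_sum:
  fixes q :: "'a::comm_ring_1"
  assumes "j \<le> k"
  shows "(\<Sum>i<k. L_mat k q $$ (i, j) * f i)
    = (if j = 0 then 0 else q * f (j - 1)) - (if j < k then f j else 0)"
proof -
  have "(\<Sum>i<k. L_mat k q $$ (i, j) * f i)
      = (\<Sum>i<k. (if i = j - 1 then (if j = 0 then 0 else q * f i) else 0)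
          - (if i = j then f i else 0))"
    using assms by (intro sum.cong) (auto simp: L_mat_def)
  also have "\<dots> = (if j = 0 then 0 else q * f (j - 1)) - (if j < k then f j else 0)"
    using assms by (cases j) (auto simp: sum_subtractf)
  finally show ?thesis .
qed

lemma L_mat_mult_Lambda_mat: "L_mat k q * Lambda_mat k q = 0\<^sub>m k 1"
proof (rule eq_matI)
  fix i j assume "i < dim_row (0\<^sub>m k 1 :: 'a mat)" "j < dim_col (0\<^sub>m k 1 :: 'a mat)"
  then have i: "i < k" "j = 0" by auto
  then have "(L_mat k q * Lambda_mat k q) $$ (i, j) = (\<Sum>h<k + 1. L_mat k q $$ (i, h) * q ^ (k - h))"
    by (simp add: L_mat_def Lambda_mat_def scalar_prod_def lessThan_atLeast0)
  also have "\<dots> = q * q ^ (k - Suc i) - q ^ (k - i)" using i by (intro L_mat_row_sum)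
  also have "\<dots> = 0" using i by (simp add: Suc_diff_Suc flip: power_Suc)
  finally show "(L_mat k q * Lambda_mat k q) $$ (i, j) = 0\<^sub>m k 1 $$ (i, j)" using i by simp
qed (auto simp: L_mat_def Lambda_mat_def)

lemma kronecker_L_mat_Lambda_mat:
  fixes v :: "'a::comm_ring_1 vec"
  assumes "v \<in> carrier_vec n"
  shows "kronecker (L_mat k q) (1\<^sub>m n) *\<^sub>v (kronecker (Lambda_mat k q) (1\<^sub>m n) *\<^sub>v v) = 0\<^sub>v (k * n)"
  using assms kronecker_zero_mult_vec[of v 1 n k]
  by (subst kronecker_one_mult_vec_mult[OF L_mat_carrier Lambda_mat_carrier])
    (auto simp: L_mat_mult_Lambda_mat)

lemma kronecker_Lambda_mat_index:
  fixes v :: "'a::comm_ring_1 vec"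
  assumes "v \<in> carrier_vec n" "i \<le> k" "a < n"
  shows "(kronecker (Lambda_mat k q) (1\<^sub>m n) *\<^sub>v v) $ (i * n + a) = q ^ (k - i) * v $ a"
  using assms
  by (subst kronecker_one_mult_vec_index[OF Lambda_mat_carrier]) (auto simp: Lambda_mat_def)

lemma kronecker_L_mat_null:
  fixes u :: "'a::comm_ring_1 vec"
  assumes u: "u \<in> carrier_vec ((k + 1) * n)"
    and null: "kronecker (L_mat k q) (1\<^sub>m n) *\<^sub>v u = 0\<^sub>v (k * n)"
  shows "u = kronecker (Lambda_mat k q) (1\<^sub>m n) *\<^sub>v vec_block n u k"
proof (rule eq_vecI)
  show "dim_vec u = dim_vec (kronecker (Lambda_mat k q) (1\<^sub>m n) *\<^sub>v vec_block n u k)"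
    using u by (simp add: kronecker_def Lambda_mat_def)
  fix j assume "j < dim_vec (kronecker (Lambda_mat k q) (1\<^sub>m n) *\<^sub>v vec_block n u k)"
  then have "j < (k + 1) * n" by (simp add: kronecker_def Lambda_mat_def)
  then obtain i a where j: "j = i * n + a" "i < k + 1" "a < n" by (rule block_index_exhaust)
  have step: "u $ (i * n + a) = q * u $ (Suc i * n + a)" if "i < k" for i
  proof -
    have "0 = (kronecker (L_mat k q) (1\<^sub>m n) *\<^sub>v u) $ (i * n + a)"
      using that j(3) by (simp only: null) (simp add: block_index_less)
    also have "\<dots> = (\<Sum>h<k + 1. L_mat k q $$ (i, h) * u $ (h * n + a))"
      by (rule kronecker_one_mult_vec_index[OF L_mat_carrier u that j(3)])
    also have "\<dots> = q * u $ (Suc i * n + a) - u $ (i * n + a)"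
      using that by (rule L_mat_row_sum)
    finally show ?thesis by simp
  qed
  have "u $ ((k - m) * n + a) = q ^ m * u $ (k * n + a)" if "m \<le> k" for m
    using that
  proof (induction m)
    case (Suc m)
    then show ?case using step[of "k - Suc m"] by (simp add: Suc_diff_Suc mult.assoc)
  qed simp
  from this[of "k - i"] show "u $ j = (kronecker (Lambda_mat k q) (1\<^sub>m n) *\<^sub>v vec_block n u k) $ j"
    using j kronecker_Lambda_mat_index[of "vec_block n u k" n i k a q]
    by (simp add: vec_block_def)
qed

lemma l2_norm_kronecker_Lambda_mat_le:
  assumes v: "v \<in> carrier_vec n"
  shows "l2_norm (kronecker (Lambda_mat k q) (1\<^sub>m n) *\<^sub>v v)
    \<le> (real k + 1) * max 1 (cmod q) ^ k * l2_norm v" (is "l2_norm ?u \<le> _")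
proof -
  have u: "?u \<in> carrier_vec ((k + 1) * n)"
    using kronecker_one_carrier[OF Lambda_mat_carrier[of k q], of n] v
    by (intro mult_mat_vec_carrier) auto
  have "l2_norm (vec_block n ?u i) \<le> max 1 (cmod q) ^ k * l2_norm v" if "i < k + 1" for i
  proof -
    have "vec_block n ?u i = q ^ (k - i) \<cdot>\<^sub>v v"
      using that v kronecker_Lambda_mat_index[OF v, where i = i and k = k and q = q]
      by (intro eq_vecI) (auto simp: vec_block_def simp del: index_mult_mat_vec)
    moreover have "cmod q ^ (k - i) \<le> max 1 (cmod q) ^ k"
    proof -
      have "cmod q ^ (k - i) \<le> max 1 (cmod q) ^ (k - i)" by (intro power_mono) auto
      also have "\<dots> \<le> max 1 (cmod q) ^ k" by (intro power_increasing) auto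
      finally show ?thesis .
    qed
    ultimately show ?thesis by (simp add: l2_norm_smult norm_power mult_right_mono)
  qed
  then have "(\<Sum>i<k + 1. l2_norm (vec_block n ?u i)) \<le> real (card {..<k + 1}) * (max 1 (cmod q) ^ k * l2_norm v)"
    by (intro sum_bounded_above) auto
  then show ?thesis using l2_norm_le_sum_blocks[OF u] by (simp add: mult.assoc add.commute)
qed

text \<open>The recurrence is run upwards from \<open>N 0\<close> if \<open>q \<le> 1\<close> and downwards from \<open>N (k - 1)\<close>
  otherwise, so that errors are never amplified.\<close>

lemma two_sided_recurrence_bound:
  fixes N :: "nat \<Rightarrow> real"
  assumes q: "0 \<le> q" and r: "0 \<le> r"
    and first: "N 0 \<le> r"
    and up: "\<And>i. Suc i < k \<Longrightarrow> N (Suc i) \<le> q * N i + r"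
    and down: "\<And>i. Suc i < k \<Longrightarrow> q * N i \<le> N (Suc i) + r"
    and last: "q * N (k - 1) \<le> r"
    and N: "\<And>i. 0 \<le> N i"
    and i: "i < k"
  shows "max 1 q * N i \<le> real k * r"
proof (cases "q \<le> 1")
  case True
  have "N i \<le> real (Suc i) * r" using i
  proof (induction i)
    case (Suc i)
    have "q * N i \<le> N i" using True N[of i] by (simp add: mult_left_le_one_le q)
    then show ?case using up[OF Suc.prems] Suc by (simp add: distrib_right)
  qed (simp add: first)
  also have "\<dots> \<le> real k * r" using i r by (intro mult_right_mono) auto
  finally show ?thesis using True by (simp add: max_def)
next
  case False
  have "q * N (k - Suc m) \<le> real (Suc m) * r" if "m < k" for m
    using that
  proof (induction m)
    case (Suc m)
    have e: "Suc (k - Suc (Suc m)) = k - Suc m" using Suc.prems by simp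
    have "N (k - Suc m) \<le> q * N (k - Suc m)"
      using False N[of "k - Suc m"] by (simp add: mult_le_cancel_right1)
    then show ?case using down[of "k - Suc (Suc m)"] Suc e by (simp add: distrib_right)
  qed (use last in simp)
  from this[of "k - Suc i"] have "q * N i \<le> real (k - i) * r" using i by (simp add: Suc_diff_Suc)
  also have "\<dots> \<le> real k * r" using r by (intro mult_right_mono) auto
  finally show ?thesis using False by (simp add: max_def)
qed

lemma l2_norm_kronecker_L_mat_transpose_bound:
  assumes s: "s \<in> carrier_vec (k * n)" and r: "r \<in> carrier_vec ((k + 1) * n)"
    and eq: "r + kronecker (L_mat k q)\<^sup>T (1\<^sub>m n) *\<^sub>v s = 0\<^sub>v ((k + 1) * n)"
  shows "max 1 (cmod q) * l2_norm s \<le> (real k)\<^sup>2 * l2_norm r"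
proof -
  have LT: "(L_mat k q)\<^sup>T \<in> carrier_mat (k + 1) k" by (auto simp: L_mat_def)
  have idx: "r $ (j * n + a) = (if j < k then s $ (j * n + a) else 0)
      - (if j = 0 then 0 else q * s $ ((j - 1) * n + a))" if "j \<le> k" "a < n" for j a
  proof -
    have j: "j < k + 1" using that by simp
    have "0 = (r + kronecker (L_mat k q)\<^sup>T (1\<^sub>m n) *\<^sub>v s) $ (j * n + a)"
      unfolding eq using block_index_less[OF j that(2)] by simp
    also have "\<dots> = r $ (j * n + a) + (kronecker (L_mat k q)\<^sup>T (1\<^sub>m n) *\<^sub>v s) $ (j * n + a)"
      using block_index_less[OF j that(2)]
      by (intro index_add_vec) (simp add: kronecker_def L_mat_def)
    also have "(kronecker (L_mat k q)\<^sup>T (1\<^sub>m n) *\<^sub>v s) $ (j * n + a)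
        = (\<Sum>i<k. L_mat k q $$ (i, j) * s $ (i * n + a))"
      unfolding kronecker_one_mult_vec_index[OF LT s j that(2)]
      using j by (intro sum.cong) (auto simp: L_mat_def)
    also have "\<dots> = (if j = 0 then 0 else q * s $ ((j - 1) * n + a))
        - (if j < k then s $ (j * n + a) else 0)"
      using that by (intro L_mat_col_sum)
    finally show ?thesis by (simp add: algebra_simps split: if_splits)
  qed
  define N where "N i = l2_norm (vec_block n s i)" for i
  have R: "l2_norm (vec_block n r j) \<le> l2_norm r" if "j \<le> k" for j
    using l2_norm_block_le[OF r, of j] that by simp
  have bound: "max 1 (cmod q) * N i \<le> real k * l2_norm r" if i: "i < k" for i
  proof (rule two_sided_recurrence_bound[OF _ _ _ _ _ _ _ i])
    have "vec_block n s 0 = vec_block n r 0"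
      using i idx[of 0] by (intro eq_vecI) (auto simp: vec_block_def)
    then show "N 0 \<le> l2_norm r" using R[of 0] by (simp add: N_def)
  next
    have "q \<cdot>\<^sub>v vec_block n s (k - 1) = (- 1) \<cdot>\<^sub>v vec_block n r k"
      using i idx[of k] by (intro eq_vecI) (auto simp: vec_block_def)
    then have "cmod q * N (k - 1) = l2_norm (vec_block n r k)"
      unfolding N_def by (metis l2_norm_smult mult_1 norm_minus_cancel norm_one)
    then show "cmod q * N (k - 1) \<le> l2_norm r" using R[of k] by simp
  next
    fix i assume i: "Suc i < k"
    have "vec_block n s (Suc i) = q \<cdot>\<^sub>v vec_block n s i + vec_block n r (Suc i)"
      using i idx[of "Suc i"] by (intro eq_vecI) (auto simp: vec_block_def)
    then have "N (Suc i) \<le> l2_norm (q \<cdot>\<^sub>v vec_block n s i) + l2_norm (vec_block n r (Suc i))"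
      unfolding N_def by (simp only:) (rule l2_norm_add[of _ n]; simp)
    then show "N (Suc i) \<le> cmod q * N i + l2_norm r"
      using R[of "Suc i"] i by (simp add: N_def l2_norm_smult)
    have "q \<cdot>\<^sub>v vec_block n s i = vec_block n s (Suc i) + (- 1) \<cdot>\<^sub>v vec_block n r (Suc i)"
      using i idx[of "Suc i"] by (intro eq_vecI) (auto simp: vec_block_def)
    then have "l2_norm (q \<cdot>\<^sub>v vec_block n s i)
        \<le> l2_norm (vec_block n s (Suc i)) + l2_norm ((- 1) \<cdot>\<^sub>v vec_block n r (Suc i))"
      by (simp only:) (rule l2_norm_add[of _ n]; simp)
    then show "cmod q * N i \<le> N (Suc i) + l2_norm r"
      using R[of "Suc i"] i by (simp add: N_def l2_norm_smult)
  qed (simp_all add: N_def)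
  have "max 1 (cmod q) * l2_norm s \<le> max 1 (cmod q) * (\<Sum>i<k. N i)"
    unfolding N_def by (intro mult_left_mono l2_norm_le_sum_blocks[OF s]) auto
  also have "\<dots> = (\<Sum>i<k. max 1 (cmod q) * N i)" by (rule sum_distrib_left)
  also have "\<dots> \<le> real (card {..<k}) * (real k * l2_norm r)"
    using bound by (intro sum_bounded_above) auto
  finally show ?thesis by (simp add: power2_eq_square)
qed

section \<open>Evaluation and differentiation\<close>

definition vp_eval :: "complex poly vec \<Rightarrow> complex \<Rightarrow> complex vec" where
  "vp_eval X z = map_vec (\<lambda>p. poly p z) X"

abbreviation vp_const :: "complex vec \<Rightarrow> complex poly vec" where
  "vp_const \<equiv> map_vec (\<lambda>c. [:c:])"

lemma dim_mp_eval [simp]: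
  "dim_row (mp_eval P z) = dim_row P" "dim_col (mp_eval P z) = dim_col P"
  by (auto simp: mp_eval_def)

lemma mp_eval_carrier [simp]: "mp_eval P z \<in> carrier_mat r c \<longleftrightarrow> P \<in> carrier_mat r c"
  by (auto simp: mp_eval_def)

lemma mp_coeff_carrier [simp]: "mp_coeff P t \<in> carrier_mat r c \<longleftrightarrow> P \<in> carrier_mat r c"
  by (auto simp: mp_coeff_def)

lemma vp_eval_const [simp]: "vp_eval (vp_const v) z = v"
  by (auto simp: vp_eval_def)

lemma vp_eval_append [simp]: "vp_eval (X @\<^sub>v Y) z = vp_eval X z @\<^sub>v vp_eval Y z"
  by (auto simp: vp_eval_def)

lemma vp_eval_carrier [simp]: "vp_eval X z \<in> carrier_vec n \<longleftrightarrow> X \<in> carrier_vec n"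
  by (auto simp: vp_eval_def)

lemma vp_eval_mult_mat_vec:
  assumes "A \<in> carrier_mat r c" "X \<in> carrier_vec c"
  shows "vp_eval (A *\<^sub>v X) z = mp_eval A z *\<^sub>v vp_eval X z"
  unfolding mp_eval_def vp_eval_def using assms
  by (rule semiring_hom.mult_mat_vec_hom[OF poly_hom.semiring_hom_axioms])

lemma mp_eval_transpose: "mp_eval P\<^sup>T z = (mp_eval P z)\<^sup>T"
  by (auto simp: mp_eval_def)

lemma mp_coeff_transpose: "mp_coeff P\<^sup>T t = (mp_coeff P t)\<^sup>T"
  by (auto simp: mp_coeff_def)

lemma mp_grade_transpose [simp]: "mp_grade l P\<^sup>T \<longleftrightarrow> mp_grade l P"
proof -
  have "mp_coeff P\<^sup>T i = 0\<^sub>m (dim_col P) (dim_row P) \<longleftrightarrow> mp_coeff P i = 0\<^sub>m (dim_row P) (dim_col P)" for i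
    unfolding mp_coeff_transpose by (metis transpose_transpose zero_transpose_mat)
  then show ?thesis by (simp add: mp_grade_def)
qed

lemma mp_eval_kronecker_one: "mp_eval (kronecker A (1\<^sub>m n)) z = kronecker (mp_eval A z) (1\<^sub>m n)"
  by (cases "n = 0"; rule eq_matI) (auto simp: mp_eval_def kronecker_def less_mult_imp_div_less)

lemma mp_eval_L_mat: "mp_eval (L_mat k (monom 1 l)) z = L_mat k (z ^ l)"
  by (rule eq_matI) (auto simp: mp_eval_def L_mat_def poly_monom)

lemma mp_eval_Lambda_mat: "mp_eval (Lambda_mat k (monom 1 l)) z = Lambda_mat k (z ^ l)"
  by (rule eq_matI) (auto simp: mp_eval_def Lambda_mat_def poly_monom)

lemma vp_eval_kronecker_Lambda_mat:
  assumes "v \<in> carrier_vec n"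
  shows "vp_eval (kronecker (Lambda_mat k (monom 1 l)) (1\<^sub>m n) *\<^sub>v vp_const v) z
    = kronecker (Lambda_mat k (z ^ l)) (1\<^sub>m n) *\<^sub>v v"
  using assms kronecker_one_carrier[OF Lambda_mat_carrier[of k "monom 1 l :: complex poly"], of n]
  by (subst vp_eval_mult_mat_vec[of _ "(k + 1) * n" n])
    (auto simp: mp_eval_kronecker_one mp_eval_Lambda_mat)

lemma poly_eq_sum_coeff_le:
  fixes p :: "'a::comm_semiring_1 poly"
  assumes "\<And>i. i > l \<Longrightarrow> coeff p i = 0"
  shows "poly p z = (\<Sum>t\<le>l. z ^ t * coeff p t)"
proof -
  have "degree p \<le> l" using assms by (intro degree_le) auto
  then have "(\<Sum>t\<le>l. coeff p t * z ^ t) = (\<Sum>t\<le>degree p. coeff p t * z ^ t)"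
    by (intro sum.mono_neutral_right) (auto simp: coeff_eq_0)
  then show ?thesis by (simp add: poly_altdef mult.commute)
qed

lemma mp_eval_mult_vec_index:
  assumes "mp_grade l M" "v \<in> carrier_vec (dim_col M)" "i < dim_row M"
  shows "(mp_eval M z *\<^sub>v v) $ i = (\<Sum>t\<le>l. (z ^ t \<cdot>\<^sub>v (mp_coeff M t *\<^sub>v v)) $ i)"
proof -
  have c: "coeff (M $$ (i, j)) t = 0" if "t > l" "j < dim_col M" for t j
  proof -
    have "mp_coeff M t $$ (i, j) = 0\<^sub>m (dim_row M) (dim_col M) $$ (i, j)"
      using that(1) assms(1) by (simp add: mp_grade_def)
    then show ?thesis using that(2) assms(3) by (simp add: mp_coeff_def)
  qed
  have "(mp_eval M z *\<^sub>v v) $ i = (\<Sum>j<dim_col M. poly (M $$ (i, j)) z * v $ j)"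
    using assms by (subst mult_mat_vec_index_sum) (auto simp: mp_eval_def)
  also have "\<dots> = (\<Sum>j<dim_col M. \<Sum>t\<le>l. z ^ t * (coeff (M $$ (i, j)) t * v $ j))"
    using c by (intro sum.cong refl)
      (subst poly_eq_sum_coeff_le[where l = l], auto simp: sum_distrib_right mult.assoc)
  also have "\<dots> = (\<Sum>t\<le>l. z ^ t * (\<Sum>j<dim_col M. coeff (M $$ (i, j)) t * v $ j))"
    by (subst sum.swap) (simp add: sum_distrib_left)
  also have "\<dots> = (\<Sum>t\<le>l. (z ^ t \<cdot>\<^sub>v (mp_coeff M t *\<^sub>v v)) $ i)"
    using assms by (intro sum.cong refl)
      (auto simp: mp_coeff_def mult_mat_vec_index_sum simp del: index_mult_mat_vec)
  finally show ?thesis .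
qed

lemma l2_norm_mp_eval_mult_vec_le:
  assumes "mp_grade l M" "v \<in> carrier_vec (dim_col M)"
  shows "l2_norm (mp_eval M z *\<^sub>v v)
    \<le> (\<Sum>t\<le>l. cmod z ^ t * spectral_norm (mp_coeff M t)) * l2_norm v"
proof -
  have "l2_norm (mp_eval M z *\<^sub>v v)
      = L2_set (\<lambda>i. cmod (\<Sum>t\<le>l. (z ^ t \<cdot>\<^sub>v (mp_coeff M t *\<^sub>v v)) $ i)) {..<dim_row M}"
    unfolding l2_norm_L2_set using assms
    by (intro L2_set_cong) (auto simp: mp_eval_mult_vec_index simp del: index_mult_mat_vec index_smult_vec)
  also have "\<dots> \<le> (\<Sum>t\<le>l. L2_set (\<lambda>i. cmod ((z ^ t \<cdot>\<^sub>v (mp_coeff M t *\<^sub>v v)) $ i)) {..<dim_row M})"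
    by (rule L2_set_cmod_sum) simp
  also have "\<dots> = (\<Sum>t\<le>l. l2_norm (z ^ t \<cdot>\<^sub>v (mp_coeff M t *\<^sub>v v)))"
    by (simp add: l2_norm_L2_set mp_coeff_def del: index_mult_mat_vec index_smult_vec(1))
  also have "\<dots> \<le> (\<Sum>t\<le>l. cmod z ^ t * spectral_norm (mp_coeff M t) * l2_norm v)"
  proof (intro sum_mono)
    fix t
    have "l2_norm (mp_coeff M t *\<^sub>v v) \<le> spectral_norm (mp_coeff M t) * l2_norm v"
      using assms(2) by (intro l2_norm_mult_mat_vec_le) (simp add: mp_coeff_def)
    then show "l2_norm (z ^ t \<cdot>\<^sub>v (mp_coeff M t *\<^sub>v v))
        \<le> cmod z ^ t * spectral_norm (mp_coeff M t) * l2_norm v"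
      by (simp add: l2_norm_smult norm_power mult.assoc mult_left_mono)
  qed
  finally show ?thesis by (simp add: sum_distrib_right)
qed

lemma pderiv_scalar_prod_mult_mat_vec:
  assumes L: "L \<in> carrier_mat r c" and X: "X \<in> carrier_vec c" and Y: "Y \<in> carrier_vec r"
  shows "poly (pderiv (Y \<bullet> (L *\<^sub>v X))) z
    = vp_eval (map_vec pderiv Y) z \<bullet> (mp_eval L z *\<^sub>v vp_eval X z)
      + vp_eval Y z \<bullet> (mp_eval (mp_deriv L) z *\<^sub>v vp_eval X z)
      + vp_eval Y z \<bullet> (mp_eval L z *\<^sub>v vp_eval (map_vec pderiv X) z)"
proof -
  have form: "B \<bullet> (K *\<^sub>v A) = (\<Sum>i<r. \<Sum>j<c. B $ i * (K $$ (i, j) * A $ j))"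
    if "A \<in> carrier_vec c" "B \<in> carrier_vec r" "K \<in> carrier_mat r c"
    for A B and K :: "'a::comm_ring_1 mat"
    using that by (auto simp: scalar_prod_def lessThan_atLeast0 sum_distrib_left intro!: sum.cong)
  have "Y \<bullet> (L *\<^sub>v X) = (\<Sum>i<r. \<Sum>j<c. Y $ i * (L $$ (i, j) * X $ j))"
    by (rule form[OF X Y L])
  then have "poly (pderiv (Y \<bullet> (L *\<^sub>v X))) z
      = (\<Sum>i<r. \<Sum>j<c. poly (pderiv (Y $ i)) z * (poly (L $$ (i, j)) z * poly (X $ j) z)
          + poly (Y $ i) z * (poly (pderiv (L $$ (i, j))) z * poly (X $ j) z)
          + poly (Y $ i) z * (poly (L $$ (i, j)) z * poly (pderiv (X $ j)) z))"
    by (simp add: pderiv_sum pderiv_mult poly_sum algebra_simps)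
  also have "\<dots> = vp_eval (map_vec pderiv Y) z \<bullet> (mp_eval L z *\<^sub>v vp_eval X z)
      + vp_eval Y z \<bullet> (mp_eval (mp_deriv L) z *\<^sub>v vp_eval X z)
      + vp_eval Y z \<bullet> (mp_eval L z *\<^sub>v vp_eval (map_vec pderiv X) z)"
    using L X Y
    by (subst (1 2 3) form) (auto simp: mp_deriv_def sum.distrib vp_eval_def mp_eval_def)
  finally show ?thesis .
qed

section \<open>Simple eigenvalues\<close>

lemma linear_factor_dvd_mult_null_vec:
  assumes "P \<in> carrier_mat n n" "v \<in> carrier_vec n" "i < n"
    and "mp_eval P z *\<^sub>v v = 0\<^sub>v n"
  shows "[:- z, 1:] dvd (P *\<^sub>v vp_const v) $ i"
proof -
  have "poly ((P *\<^sub>v vp_const v) $ i) z = vp_eval (P *\<^sub>v vp_const v) z $ i"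
    using assms by (simp add: vp_eval_def)
  also have "\<dots> = 0" using assms by (subst vp_eval_mult_mat_vec[of _ n n]) auto
  finally show ?thesis by (simp add: poly_eq_0_iff_dvd)
qed

lemma square_dvd_det_of_two_cols:
  fixes A :: "'a::comm_ring_1 mat"
  assumes A: "A \<in> carrier_mat n n" and ij: "i < n" "j < n" "i \<noteq> j"
    and i: "\<And>r. r < n \<Longrightarrow> f dvd A $$ (r, i)" and j: "\<And>r. r < n \<Longrightarrow> f dvd A $$ (r, j)"
  shows "f ^ 2 dvd det A"
  unfolding det_col[OF A]
proof (intro dvd_sum dvd_mult)
  fix p assume "p \<in> {p. p permutes {0..<n}}"
  then have p: "p permutes {0..<n}" by simp
  have pn: "p k < n" if "k < n" for k using permutes_in_image[OF p, of k] that by simp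
  have "(\<Prod>k\<in>{..<n}. A $$ (p k, k))
      = A $$ (p i, i) * (A $$ (p j, j) * (\<Prod>k\<in>{..<n} - {i} - {j}. A $$ (p k, k)))"
    using ij by (subst prod.remove[of _ i], simp, simp, subst prod.remove[of _ j]) auto
  moreover have "f * (f * 1) dvd A $$ (p i, i) * (A $$ (p j, j) * (\<Prod>k\<in>{..<n} - {i} - {j}. A $$ (p k, k)))"
    using ij i[OF pn] j[OF pn] by (intro mult_dvd_mono) auto
  ultimately show "f ^ 2 dvd (\<Prod>k<n. A $$ (p k, k))"
    by (simp add: power2_eq_square)
qed

lemma simple_eigenvalue_kernel:
  assumes P: "P \<in> carrier_mat n n" and simple: "mp_simple_eigenvalue P z"
    and x: "x \<in> carrier_vec n" "x \<noteq> 0\<^sub>v n" "mp_eval P z *\<^sub>v x = 0\<^sub>v n"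
    and v: "v \<in> carrier_vec n" "mp_eval P z *\<^sub>v v = 0\<^sub>v n"
  shows "\<exists>c. v = c \<cdot>\<^sub>v x"
proof -
  obtain i where i: "i < n" "x $ i \<noteq> 0" using x(1,2) by (metis eq_vecI carrier_vecD index_zero_vec)
  define c where "c = v $ i / x $ i"
  define w where "w = v - c \<cdot>\<^sub>v x"
  have w: "w \<in> carrier_vec n" using v x by (simp add: w_def)
  have wi: "w $ i = 0" using i v x by (simp add: w_def c_def)
  have Pw: "mp_eval P z *\<^sub>v w = 0\<^sub>v n"
    unfolding w_def using P x v
    by (subst mult_minus_distrib_mat_vec[of _ n n]) (auto simp: mult_mat_vec[of _ n n])
  have "w = 0\<^sub>v n"
  proof (rule ccontr)
    assume "w \<noteq> 0\<^sub>v n"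
    then obtain j where j: "j < n" "w $ j \<noteq> 0" using w by (metis eq_vecI carrier_vecD index_zero_vec)
    with wi have ij: "i \<noteq> j" by auto
    define X where "X = vp_const x"
    define W where "W = vp_const w"
    have XW: "X \<in> carrier_vec n" "W \<in> carrier_vec n" using x w by (auto simp: X_def W_def)
    define A where "A = replace_col P (P *\<^sub>v X) i"
    define B where "B = replace_col A (A *\<^sub>v W) j"
    have A: "A \<in> carrier_mat n n" and B: "B \<in> carrier_mat n n"
      using P by (auto simp: A_def B_def replace_col_def)
    have "det B = W $ j * (X $ i * det P)"
      unfolding B_def cramer_lemma_mat[OF A XW(2) j(1)]
      unfolding A_def cramer_lemma_mat[OF P XW(1) i(1)] ..
    then have dB: "det B = Polynomial.smult (w $ j * x $ i) (det P)"
      using i j w x by (simp add: X_def W_def mult.commute)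
    have AW: "(A *\<^sub>v W) $ r = (P *\<^sub>v W) $ r" if "r < n" for r
    proof -
      have "(A *\<^sub>v W) $ r = (\<Sum>k<n. A $$ (r, k) * W $ k)"
        using A XW that by (subst mult_mat_vec_index_sum) auto
      also have "\<dots> = (\<Sum>k<n. P $$ (r, k) * W $ k)"
        using P that wi w i by (intro sum.cong) (auto simp: A_def replace_col_def W_def)
      also have "\<dots> = (P *\<^sub>v W) $ r"
        using P XW that by (subst mult_mat_vec_index_sum) auto
      finally show ?thesis .
    qed
    have "[:- z, 1:] ^ 2 dvd det B"
    proof (rule square_dvd_det_of_two_cols[OF B i(1) j(1) ij])
      fix r assume r: "r < n"
      have "B $$ (r, i) = (P *\<^sub>v X) $ r"
        using r ij i P by (simp add: A_def B_def replace_col_def)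
      then show "[:- z, 1:] dvd B $$ (r, i)"
        using linear_factor_dvd_mult_null_vec[OF P x(1) r x(3)] by (simp add: X_def)
      have "B $$ (r, j) = (A *\<^sub>v W) $ r"
        using r ij j A by (simp add: B_def replace_col_def)
      then show "[:- z, 1:] dvd B $$ (r, j)"
        using linear_factor_dvd_mult_null_vec[OF P w r Pw] AW[OF r] by (simp add: W_def)
    qed
    then have "[:- z, 1:] ^ 2 dvd det P"
      using i j by (simp add: dB dvd_smult_iff)
    then show False using simple order_max[of z 2 "det P"] by (simp add: mp_simple_eigenvalue_def)
  qed
  have "v $ k = (c \<cdot>\<^sub>v x) $ k" if "k < n" for k
    using arg_cong[OF \<open>w = 0\<^sub>v n\<close>, of "\<lambda>u. u $ k"] that v x by (simp add: w_def)
  then have "v = c \<cdot>\<^sub>v x" using v x by (intro eq_vecI) auto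
  then show ?thesis ..
qed

section \<open>Block Kronecker forms\<close>

lemma map_four_block_mat:
  assumes "A \<in> carrier_mat r1 c1" "B \<in> carrier_mat r1 c2" "C \<in> carrier_mat r2 c1" "D \<in> carrier_mat r2 c2"
  shows "map_mat f (four_block_mat A B C D)
    = four_block_mat (map_mat f A) (map_mat f B) (map_mat f C) (map_mat f D)"
  using assms by (intro eq_matI) auto

lemma zero_mat_mult_vec:
  fixes v :: "'a::semiring_0 vec"
  assumes "v \<in> carrier_vec c"
  shows "0\<^sub>m r c *\<^sub>v v = 0\<^sub>v r"
  using assms by (intro eq_vecI) auto

lemma four_block_mat_mult_vec_eq_0:
  fixes A B C D :: "'a::comm_ring_1 mat"
  assumes carr: "A \<in> carrier_mat r1 c1" "B \<in> carrier_mat r1 c2" "C \<in> carrier_mat r2 c1"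
      "D \<in> carrier_mat r2 c2" "a \<in> carrier_vec c1" "b \<in> carrier_vec c2"
    and null: "four_block_mat A B C D *\<^sub>v (a @\<^sub>v b) = 0\<^sub>v (r1 + r2)"
  shows "A *\<^sub>v a + B *\<^sub>v b = 0\<^sub>v r1" "C *\<^sub>v a + D *\<^sub>v b = 0\<^sub>v r2"
proof -
  have "(A *\<^sub>v a + B *\<^sub>v b) @\<^sub>v (C *\<^sub>v a + D *\<^sub>v b) = 0\<^sub>v (r1 + r2)"
    using four_block_mat_mult_vec[OF carr] null by simp
  also have "0\<^sub>v (r1 + r2) = (0\<^sub>v r1 @\<^sub>v 0\<^sub>v r2 :: 'a vec)" by (intro eq_vecI) auto
  finally show "A *\<^sub>v a + B *\<^sub>v b = 0\<^sub>v r1" "C *\<^sub>v a + D *\<^sub>v b = 0\<^sub>v r2"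
    using carr by (simp_all add: append_vec_eq[of _ r1])
qed

lemma L_block_carrier [simp]:
  "kronecker (L_mat k q) (1\<^sub>m n) \<in> carrier_mat (k * n) ((k + 1) * n)"
  "kronecker (L_mat k q)\<^sup>T (1\<^sub>m n) \<in> carrier_mat ((k + 1) * n) (k * n)"
  by (auto intro!: kronecker_one_carrier simp del: add_Suc_right Suc_eq_plus1 simp: L_mat_def)

lemma Lambda_block_carrier [simp]:
  "kronecker (Lambda_mat k q) (1\<^sub>m n) \<in> carrier_mat ((k + 1) * n) n"
  using kronecker_one_carrier[OF Lambda_mat_carrier[of k q], of n] by simp

lemma Lambda_block_mult_vec_carrier:
  "v \<in> carrier_vec n \<Longrightarrow> kronecker (Lambda_mat k q) (1\<^sub>m n) *\<^sub>v v \<in> carrier_vec ((k + 1) * n)"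
  by (rule mult_mat_vec_carrier[OF Lambda_block_carrier])

lemma block_kronecker_form_carrier:
  assumes "M \<in> carrier_mat ((\<eta> + 1) * n) ((\<epsilon> + 1) * n)"
  shows "block_kronecker_form \<epsilon> n \<eta> l M
    \<in> carrier_mat ((\<eta> + 1) * n + \<epsilon> * n) ((\<epsilon> + 1) * n + \<eta> * n)"
  unfolding block_kronecker_form_def using assms by (intro four_block_carrier_mat) auto

lemma block_kronecker_form_transpose:
  assumes "M \<in> carrier_mat ((\<eta> + 1) * n) ((\<epsilon> + 1) * n)"
  shows "(block_kronecker_form \<epsilon> n \<eta> l M)\<^sup>T = block_kronecker_form \<eta> n \<epsilon> l M\<^sup>T"
  unfolding block_kronecker_form_def
  using transpose_four_block_mat[OF assms L_block_carrier(2) L_block_carrier(1) zero_carrier_mat]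
  by (simp add: kronecker_one_transpose)

lemma block_kronecker_condition_transpose:
  assumes "block_kronecker_condition \<epsilon> n \<eta> l M P"
  shows "block_kronecker_condition \<eta> n \<epsilon> l M\<^sup>T P\<^sup>T"
proof -
  let ?E = "kronecker (Lambda_mat \<epsilon> (monom 1 l :: complex poly)) (1\<^sub>m n)"
  let ?H = "kronecker (Lambda_mat \<eta> (monom 1 l :: complex poly)) (1\<^sub>m n)"
  have M: "M \<in> carrier_mat ((\<eta> + 1) * n) ((\<epsilon> + 1) * n)" and P: "P = ?H\<^sup>T * M * ?E"
    and l: "mp_grade l M"
    using assms by (auto simp: block_kronecker_condition_def kronecker_one_transpose)
  have H: "?H\<^sup>T \<in> carrier_mat n ((\<eta> + 1) * n)" using Lambda_block_carrier by (simp only: transpose_carrier_mat)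
  have "P\<^sup>T = ?E\<^sup>T * (?H\<^sup>T * M)\<^sup>T"
    unfolding P by (rule transpose_mult[OF mult_carrier_mat[OF H M] Lambda_block_carrier])
  also have "(?H\<^sup>T * M)\<^sup>T = M\<^sup>T * ?H" using transpose_mult[OF H M] by simp
  also have "?E\<^sup>T * (M\<^sup>T * ?H) = ?E\<^sup>T * M\<^sup>T * ?H"
    using M Lambda_block_carrier
    by (intro assoc_mult_mat[symmetric, of _ n "(\<epsilon> + 1) * n" _ "(\<eta> + 1) * n" _ n])
      (simp_all only: transpose_carrier_mat)
  finally show ?thesis
    using M l by (simp add: block_kronecker_condition_def kronecker_one_transpose)
qed

lemma block_kronecker_condition_carrier:
  assumes "block_kronecker_condition \<epsilon> n \<eta> l M P"
  shows "M \<in> carrier_mat ((\<eta> + 1) * n) ((\<epsilon> + 1) * n)" "P \<in> carrier_mat n n"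
  using assms unfolding block_kronecker_condition_def by (auto simp: kronecker_def Lambda_mat_def)

lemma block_kronecker_bilinear:
  assumes cond: "block_kronecker_condition \<epsilon> n \<eta> l M P"
    and V: "V \<in> carrier_vec n" and W: "W \<in> carrier_vec n"
    and S: "S \<in> carrier_vec (\<eta> * n)" and T: "T \<in> carrier_vec (\<epsilon> * n)"
  shows "((kronecker (Lambda_mat \<eta> (monom 1 l)) (1\<^sub>m n) *\<^sub>v W) @\<^sub>v T)
      \<bullet> (block_kronecker_form \<epsilon> n \<eta> l M
          *\<^sub>v ((kronecker (Lambda_mat \<epsilon> (monom 1 l)) (1\<^sub>m n) *\<^sub>v V) @\<^sub>v S))
    = W \<bullet> (P *\<^sub>v V)"
proof -
  let ?q = "monom 1 l :: complex poly"
  define E where "E = kronecker (Lambda_mat \<epsilon> ?q) (1\<^sub>m n)"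
  define H where "H = kronecker (Lambda_mat \<eta> ?q) (1\<^sub>m n)"
  define K1 where "K1 = kronecker (L_mat \<epsilon> ?q) (1\<^sub>m n)"
  define K2 where "K2 = kronecker (L_mat \<eta> ?q)\<^sup>T (1\<^sub>m n)"
  have M: "M \<in> carrier_mat ((\<eta> + 1) * n) ((\<epsilon> + 1) * n)" and P: "P = H\<^sup>T * M * E"
    using cond by (auto simp: block_kronecker_condition_def kronecker_one_transpose E_def H_def)
  have E: "E \<in> carrier_mat ((\<epsilon> + 1) * n) n" and H: "H \<in> carrier_mat ((\<eta> + 1) * n) n"
    and K1: "K1 \<in> carrier_mat (\<epsilon> * n) ((\<epsilon> + 1) * n)"
    and K2: "K2 \<in> carrier_mat ((\<eta> + 1) * n) (\<eta> * n)"
    unfolding E_def H_def K1_def K2_def by (rule Lambda_block_carrier L_block_carrier)+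
  have HT: "H\<^sup>T \<in> carrier_mat n ((\<eta> + 1) * n)" using H by simp
  have EV: "E *\<^sub>v V \<in> carrier_vec ((\<epsilon> + 1) * n)" using E V by (rule mult_mat_vec_carrier)
  have HW: "H *\<^sub>v W \<in> carrier_vec ((\<eta> + 1) * n)" using H W by (rule mult_mat_vec_carrier)
  have MEV: "M *\<^sub>v (E *\<^sub>v V) \<in> carrier_vec ((\<eta> + 1) * n)" using M EV by (rule mult_mat_vec_carrier)
  have K2S: "K2 *\<^sub>v S \<in> carrier_vec ((\<eta> + 1) * n)" using K2 S by (rule mult_mat_vec_carrier)
  have "K2\<^sup>T *\<^sub>v (H *\<^sub>v W) = 0\<^sub>v (\<eta> * n)"
    using kronecker_L_mat_Lambda_mat[OF W, of \<eta> ?q]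
    by (simp add: K2_def H_def kronecker_one_transpose)
  moreover have "(K2\<^sup>T *\<^sub>v (H *\<^sub>v W)) \<bullet> S = (H *\<^sub>v W) \<bullet> (K2 *\<^sub>v S)"
    by (rule transpose_vec_mult_scalar[OF K2 S HW])
  ultimately have 0: "(H *\<^sub>v W) \<bullet> (K2 *\<^sub>v S) = 0" using S by simp
  have "block_kronecker_form \<epsilon> n \<eta> l M *\<^sub>v ((E *\<^sub>v V) @\<^sub>v S)
      = (M *\<^sub>v (E *\<^sub>v V) + K2 *\<^sub>v S) @\<^sub>v (K1 *\<^sub>v (E *\<^sub>v V) + 0\<^sub>m (\<epsilon> * n) (\<eta> * n) *\<^sub>v S)"
    unfolding block_kronecker_form_def K1_def[symmetric] K2_def[symmetric]
    by (rule four_block_mat_mult_vec[OF M K2 K1 zero_carrier_mat EV S])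
  also have "K1 *\<^sub>v (E *\<^sub>v V) + 0\<^sub>m (\<epsilon> * n) (\<eta> * n) *\<^sub>v S = 0\<^sub>v (\<epsilon> * n)"
    using kronecker_L_mat_Lambda_mat[OF V, of \<epsilon> ?q] S by (simp add: K1_def E_def zero_mat_mult_vec)
  finally have "((H *\<^sub>v W) @\<^sub>v T) \<bullet> (block_kronecker_form \<epsilon> n \<eta> l M *\<^sub>v ((E *\<^sub>v V) @\<^sub>v S))
      = (H *\<^sub>v W) \<bullet> (M *\<^sub>v (E *\<^sub>v V) + K2 *\<^sub>v S) + T \<bullet> 0\<^sub>v (\<epsilon> * n)"
    using scalar_prod_append[OF HW T add_carrier_vec[OF MEV K2S] zero_carrier_vec] by simp
  also have "\<dots> = (H *\<^sub>v W) \<bullet> (M *\<^sub>v (E *\<^sub>v V))"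
    using 0 T by (simp add: scalar_prod_add_distrib[OF HW MEV K2S])
  also have "\<dots> = W \<bullet> (H\<^sup>T *\<^sub>v (M *\<^sub>v (E *\<^sub>v V)))"
    using transpose_vec_mult_scalar[OF HT MEV W] by simp
  also have "H\<^sup>T *\<^sub>v (M *\<^sub>v (E *\<^sub>v V)) = P *\<^sub>v V"
    unfolding P assoc_mult_mat_vec[OF mult_carrier_mat[OF HT M] E V]
      assoc_mult_mat_vec[OF HT M EV] ..
  finally show ?thesis by (simp add: E_def H_def)
qed

lemma poly_scalar_prod:
  assumes "dim_vec X = dim_vec Y"
  shows "poly (X \<bullet> Y) z = vp_eval X z \<bullet> vp_eval Y z"
  using assms by (simp add: scalar_prod_def poly_sum vp_eval_def)

lemma max_one_power:
  fixes a :: real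
  assumes "0 \<le> a"
  shows "max 1 (a ^ l) = max 1 a ^ l"
  using assms power_le_one[of a l] one_le_power[of a l] by (auto simp: max_def)

lemma power_le_max_one_power:
  fixes a :: real
  assumes "0 \<le> a" "t \<le> l"
  shows "a ^ t \<le> max 1 a ^ l"
proof -
  have "a ^ t \<le> max 1 a ^ t" using assms by (intro power_mono) auto
  also have "\<dots> \<le> max 1 a ^ l" using assms by (intro power_increasing) auto
  finally show ?thesis .
qed

lemma power_sum_le:
  fixes a :: real
  assumes "0 \<le> a" "\<And>t. t \<le> l \<Longrightarrow> f t \<le> m" "0 \<le> m"
  shows "(\<Sum>t\<le>l. a ^ t * f t) \<le> (real l + 1) * max 1 a ^ l * m"
proof -
  have "a ^ t * f t \<le> max 1 a ^ l * m" if "t \<le> l" for t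
  proof -
    have "a ^ t * f t \<le> a ^ t * m" using assms that by (intro mult_left_mono) auto
    also have "\<dots> \<le> max 1 a ^ l * m"
      using assms that by (intro mult_right_mono power_le_max_one_power) auto
    finally show ?thesis .
  qed
  then have "(\<Sum>t\<le>l. a ^ t * f t) \<le> real (card {..l}) * (max 1 a ^ l * m)"
    by (intro sum_bounded_above) auto
  then show ?thesis by (simp add: algebra_simps)
qed

lemma block_kronecker_null_vector:
  assumes cond: "block_kronecker_condition \<epsilon> n \<eta> l M P"
    and u: "u \<in> carrier_vec ((\<epsilon> + 1) * n + \<eta> * n)"
    and null: "mp_eval (block_kronecker_form \<epsilon> n \<eta> l M) z *\<^sub>v u = 0\<^sub>v ((\<eta> + 1) * n + \<epsilon> * n)"
    and m: "\<And>t. t \<le> l \<Longrightarrow> spectral_norm (mp_coeff M t) \<le> m"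
  obtains v s where "v \<in> carrier_vec n" "s \<in> carrier_vec (\<eta> * n)"
    "u = (kronecker (Lambda_mat \<epsilon> (z ^ l)) (1\<^sub>m n) *\<^sub>v v) @\<^sub>v s"
    "mp_eval P z *\<^sub>v v = 0\<^sub>v n"
    "l2_norm u \<le> (1 + (real \<eta>)\<^sup>2 * ((real l + 1) * m)) * (real \<epsilon> + 1)
      * max 1 (cmod z) ^ (l * \<epsilon>) * l2_norm v"
proof
  let ?q = "z ^ l"
  let ?E = "kronecker (Lambda_mat \<epsilon> ?q) (1\<^sub>m n)"
  let ?K1 = "kronecker (L_mat \<epsilon> ?q) (1\<^sub>m n)"
  let ?K2 = "kronecker (L_mat \<eta> ?q)\<^sup>T (1\<^sub>m n)"
  let ?L = "block_kronecker_form \<epsilon> n \<eta> l M"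
  define x where "x = vec_first u ((\<epsilon> + 1) * n)"
  define s where "s = vec_last u (\<eta> * n)"
  define v where "v = vec_block n x \<epsilon>"
  define \<mu> where "\<mu> = max 1 (cmod z)"
  note M = block_kronecker_condition_carrier(1)[OF cond]
  note P = block_kronecker_condition_carrier(2)[OF cond]
  note L = block_kronecker_form_carrier[OF M, of l]
  have grade: "mp_grade l M" using cond by (simp add: block_kronecker_condition_def)
  have x: "x \<in> carrier_vec ((\<epsilon> + 1) * n)" and s: "s \<in> carrier_vec (\<eta> * n)"
    by (simp_all only: x_def s_def vec_first_carrier vec_last_carrier)
  have v: "v \<in> carrier_vec n" by (simp add: v_def)
  have uxs: "u = x @\<^sub>v s" using vec_first_last_append[OF u] by (simp only: x_def s_def)
  have Mz: "mp_eval M z \<in> carrier_mat ((\<eta> + 1) * n) ((\<epsilon> + 1) * n)"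
    unfolding mp_eval_carrier by (rule M)
  have Lz: "mp_eval ?L z = four_block_mat (mp_eval M z) ?K2 ?K1 (0\<^sub>m (\<epsilon> * n) (\<eta> * n))"
  proof -
    have "mp_eval ?L z = four_block_mat (mp_eval M z)
        (mp_eval (kronecker (L_mat \<eta> (monom 1 l))\<^sup>T (1\<^sub>m n)) z)
        (mp_eval (kronecker (L_mat \<epsilon> (monom 1 l)) (1\<^sub>m n)) z)
        (mp_eval (0\<^sub>m (\<epsilon> * n) (\<eta> * n)) z)"
      unfolding block_kronecker_form_def mp_eval_def
      by (rule map_four_block_mat[OF M L_block_carrier(2) L_block_carrier(1) zero_carrier_mat])
    moreover have "mp_eval (0\<^sub>m (\<epsilon> * n) (\<eta> * n)) z = 0\<^sub>m (\<epsilon> * n) (\<eta> * n)"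
      by (rule eq_matI) (auto simp: mp_eval_def)
    ultimately show ?thesis
      by (simp add: mp_eval_kronecker_one mp_eval_L_mat mp_eval_transpose)
  qed
  have "four_block_mat (mp_eval M z) ?K2 ?K1 (0\<^sub>m (\<epsilon> * n) (\<eta> * n)) *\<^sub>v (x @\<^sub>v s)
      = 0\<^sub>v ((\<eta> + 1) * n + \<epsilon> * n)"
    using null unfolding Lz uxs .
  note eqs = four_block_mat_mult_vec_eq_0[OF Mz L_block_carrier(2) L_block_carrier(1)
      zero_carrier_mat x s this]
  have "?K1 *\<^sub>v x = 0\<^sub>v (\<epsilon> * n)"
    using eqs(2) unfolding zero_mat_mult_vec[OF s] right_zero_vec[OF mult_mat_vec_carrier[OF L_block_carrier(1) x]] .
  then have xv: "x = ?E *\<^sub>v v" unfolding v_def by (rule kronecker_L_mat_null[OF x])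
  show "v \<in> carrier_vec n" "s \<in> carrier_vec (\<eta> * n)" by fact+
  show uv: "u = (?E *\<^sub>v v) @\<^sub>v s" using uxs xv by simp
  have "(mp_eval P z *\<^sub>v v) $ i = 0" if i: "i < n" for i
  proof -
    let ?X = "(kronecker (Lambda_mat \<epsilon> (monom 1 l)) (1\<^sub>m n) *\<^sub>v vp_const v) @\<^sub>v vp_const s"
    let ?Y = "(kronecker (Lambda_mat \<eta> (monom 1 l)) (1\<^sub>m n) *\<^sub>v vp_const (unit_vec n i))
        @\<^sub>v vp_const (0\<^sub>v (\<epsilon> * n))"
    have X: "?X \<in> carrier_vec ((\<epsilon> + 1) * n + \<eta> * n)"
      using v s by (intro append_carrier_vec Lambda_block_mult_vec_carrier) auto
    have Y: "?Y \<in> carrier_vec ((\<eta> + 1) * n + \<epsilon> * n)"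
      by (intro append_carrier_vec Lambda_block_mult_vec_carrier) auto
    have Xz: "vp_eval ?X z = u" using v uv by (simp add: vp_eval_kronecker_Lambda_mat)
    have "(mp_eval P z *\<^sub>v v) $ i = unit_vec n i \<bullet> (mp_eval P z *\<^sub>v v)"
      using i P v by (intro scalar_prod_left_unit[symmetric] mult_mat_vec_carrier) auto
    also have "\<dots> = poly (vp_const (unit_vec n i) \<bullet> (P *\<^sub>v vp_const v)) z"
      using P v by (subst poly_scalar_prod) (auto simp: vp_eval_mult_mat_vec[of _ n n])
    also have "\<dots> = poly (?Y \<bullet> (?L *\<^sub>v ?X)) z"
      using v s by (subst block_kronecker_bilinear[OF cond]) auto
    also have "\<dots> = vp_eval ?Y z \<bullet> vp_eval (?L *\<^sub>v ?X) z"
      by (rule poly_scalar_prod)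
        (simp only: carrier_vecD[OF Y] carrier_vecD[OF mult_mat_vec_carrier[OF L X]])
    also have "\<dots> = vp_eval ?Y z \<bullet> (mp_eval ?L z *\<^sub>v u)"
      by (simp only: vp_eval_mult_mat_vec[OF L X] Xz)
    also have "\<dots> = 0"
      unfolding null using Y by (intro scalar_prod_right_zero) (simp only: vp_eval_carrier)
    finally show ?thesis .
  qed
  then show "mp_eval P z *\<^sub>v v = 0\<^sub>v n" using P by (intro eq_vecI) auto
  have m0: "0 \<le> m" using m[of 0] spectral_norm_nonneg order_trans by blast
  have \<mu>: "max 1 (cmod ?q) = \<mu> ^ l" by (simp add: norm_power max_one_power \<mu>_def)
  have \<mu>0: "0 < \<mu> ^ l" by (simp add: \<mu>_def)
  have Mx: "mp_eval M z *\<^sub>v x \<in> carrier_vec ((\<eta> + 1) * n)" using Mz x by (rule mult_mat_vec_carrier)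
  have "\<mu> ^ l * l2_norm s \<le> (real \<eta>)\<^sup>2 * l2_norm (mp_eval M z *\<^sub>v x)"
    using l2_norm_kronecker_L_mat_transpose_bound[OF s Mx eqs(1)] \<mu> by simp
  also have "\<dots> \<le> (real \<eta>)\<^sup>2 * ((\<Sum>t\<le>l. cmod z ^ t * spectral_norm (mp_coeff M t)) * l2_norm x)"
    using M x by (intro mult_left_mono l2_norm_mp_eval_mult_vec_le[OF grade]) auto
  also have "\<dots> \<le> (real \<eta>)\<^sup>2 * (((real l + 1) * \<mu> ^ l * m) * l2_norm x)"
    unfolding \<mu>_def using m m0 by (intro mult_left_mono mult_right_mono power_sum_le) auto
  finally have "\<mu> ^ l * l2_norm s \<le> \<mu> ^ l * ((real \<eta>)\<^sup>2 * ((real l + 1) * m) * l2_norm x)"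
    by (simp add: mult_ac)
  then have "l2_norm s \<le> (real \<eta>)\<^sup>2 * ((real l + 1) * m) * l2_norm x"
    using \<mu>0 by (simp only: mult_le_cancel_left_pos)
  moreover have "l2_norm u \<le> l2_norm x + l2_norm s" unfolding uxs by (rule l2_norm_append_le)
  ultimately have "l2_norm u \<le> (1 + (real \<eta>)\<^sup>2 * ((real l + 1) * m)) * l2_norm x"
    by (simp add: distrib_right)
  also have "\<dots> \<le> (1 + (real \<eta>)\<^sup>2 * ((real l + 1) * m)) * ((real \<epsilon> + 1) * (\<mu> ^ l) ^ \<epsilon> * l2_norm v)"
    using m0 l2_norm_kronecker_Lambda_mat_le[OF v, of \<epsilon> ?q] unfolding xv[symmetric] \<mu>
    by (intro mult_left_mono) auto
  finally show "l2_norm u \<le> (1 + (real \<eta>)\<^sup>2 * ((real l + 1) * m)) * (real \<epsilon> + 1)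
      * max 1 (cmod z) ^ (l * \<epsilon>) * l2_norm v"
    by (simp add: \<mu>_def power_mult mult.assoc)
qed

lemma spectral_norm_mp_coeff_kronecker_one_le:
  assumes A: "A \<in> carrier_mat r c"
    and entry: "\<And>i j. i < r \<Longrightarrow> j < c \<Longrightarrow> cmod (coeff (A $$ (i, j)) t) \<le> 1"
  shows "spectral_norm (mp_coeff (kronecker A (1\<^sub>m n)) t) \<le> real r * real c"
proof -
  let ?K = "mp_coeff (kronecker A (1\<^sub>m n)) t"
  have K: "?K \<in> carrier_mat (r * n) (c * n)" using A by simp
  have "spectral_norm (mat_block n ?K i j) \<le> 1" if ij: "i < r" "j < c" for i j
  proof -
    have "mat_block n ?K i j = coeff (A $$ (i, j)) t \<cdot>\<^sub>m 1\<^sub>m n"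
      using A ij carrier_matD[OF kronecker_one_carrier[OF A, of n]]
      by (intro eq_matI) (auto simp: mat_block_def mp_coeff_def block_index_less kronecker_one_index)
    then show ?thesis using spectral_norm_smult_one entry[OF ij] order_trans by metis
  qed
  then have "(\<Sum>i<r. \<Sum>j<c. spectral_norm (mat_block n ?K i j)) \<le> (\<Sum>i<r. \<Sum>j<c. 1)"
    by (intro sum_mono) auto
  then show ?thesis using spectral_norm_le_sum_blocks[OF K] by simp
qed

lemma spectral_norm_mp_coeff_block_kronecker_form_le:
  assumes M: "M \<in> carrier_mat ((\<eta> + 1) * n) ((\<epsilon> + 1) * n)"
  shows "spectral_norm (mp_coeff (block_kronecker_form \<epsilon> n \<eta> l M) t)
    \<le> spectral_norm (mp_coeff M t) + (real \<eta> + 1) * real \<eta> + real \<epsilon> * (real \<epsilon> + 1)"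
proof -
  let ?K1 = "kronecker (L_mat \<epsilon> (monom 1 l)) (1\<^sub>m n) :: complex poly mat"
  let ?K2 = "kronecker (L_mat \<eta> (monom 1 l))\<^sup>T (1\<^sub>m n) :: complex poly mat"
  have entry: "cmod (coeff (L_mat k (monom 1 l) $$ (i, j)) t) \<le> 1" if "i < k" "j < k + 1" for i j k
    using that by (auto simp: L_mat_def)
  have 1: "spectral_norm (mp_coeff ?K1 t) \<le> real \<epsilon> * real (\<epsilon> + 1)"
    by (rule spectral_norm_mp_coeff_kronecker_one_le[OF L_mat_carrier entry])
  have 2: "spectral_norm (mp_coeff ?K2 t) \<le> real (\<eta> + 1) * real \<eta>"
  proof (rule spectral_norm_mp_coeff_kronecker_one_le)
    show LT: "(L_mat \<eta> (monom 1 l :: complex poly))\<^sup>T \<in> carrier_mat (\<eta> + 1) \<eta>"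
      by (auto simp: L_mat_def)
    show "cmod (coeff ((L_mat \<eta> (monom 1 l))\<^sup>T $$ (i, j)) t) \<le> 1" if "i < \<eta> + 1" "j < \<eta>" for i j
      using that entry[of j \<eta> i] by (subst index_transpose_mat) (auto simp: L_mat_def)
  qed
  have 0: "mp_coeff (0\<^sub>m (\<epsilon> * n) (\<eta> * n)) t = 0\<^sub>m (\<epsilon> * n) (\<eta> * n)"
    by (rule eq_matI) (auto simp: mp_coeff_def)
  have "mp_coeff (block_kronecker_form \<epsilon> n \<eta> l M) t
      = four_block_mat (mp_coeff M t) (mp_coeff ?K2 t) (mp_coeff ?K1 t)
          (mp_coeff (0\<^sub>m (\<epsilon> * n) (\<eta> * n)) t)"
    unfolding block_kronecker_form_def mp_coeff_def
    by (rule map_four_block_mat[OF M L_block_carrier(2) L_block_carrier(1) zero_carrier_mat])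
  then have "spectral_norm (mp_coeff (block_kronecker_form \<epsilon> n \<eta> l M) t)
      \<le> spectral_norm (mp_coeff M t) + spectral_norm (mp_coeff ?K2 t)
        + spectral_norm (mp_coeff ?K1 t) + spectral_norm (mp_coeff (0\<^sub>m (\<epsilon> * n) (\<eta> * n)) t)"
    using spectral_norm_four_block_le[of "mp_coeff M t" "(\<eta> + 1) * n" "(\<epsilon> + 1) * n" "mp_coeff ?K2 t" "\<eta> * n"
        "mp_coeff ?K1 t" "\<epsilon> * n" "mp_coeff (0\<^sub>m (\<epsilon> * n) (\<eta> * n)) t"] M
      L_block_carrier(1)[of \<epsilon> "monom 1 l :: complex poly" n]
      L_block_carrier(2)[of \<eta> "monom 1 l :: complex poly" n]
    by (simp only: mp_coeff_carrier zero_carrier_mat)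
  then show ?thesis using 0 1 2 by (simp add: algebra_simps)
qed

lemma spectral_norm_mat_block_le:
  assumes B: "B \<in> carrier_mat (p * n) (q * n)" and ij: "i < p" "j < q"
  shows "spectral_norm (mat_block n B i j) \<le> spectral_norm B"
proof (rule spectral_norm_le)
  fix v :: "complex vec" assume "v \<in> carrier_vec (dim_col (mat_block n B i j))"
  then have v: "v \<in> carrier_vec n" by (simp add: mat_block_def)
  define e where "e = vec (q * n) (\<lambda>k. if k div n = j then v $ (k mod n) else 0)"
  have e: "e \<in> carrier_vec (q * n)" by (simp add: e_def)
  have e_index: "e $ (h * n + a) = (if h = j then v $ a else 0)" if "h < q" "a < n" for h a
    using that block_index_less[OF that] by (simp add: e_def)
  have "vec_block n e h = (if h = j then v else 0\<^sub>v n)" if "h < q" for h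
    using that v e_index by (intro eq_vecI) (auto simp: vec_block_def)
  then have "(\<Sum>h<q. l2_norm (vec_block n e h)) = (\<Sum>h<q. if h = j then l2_norm v else 0)"
    by (intro sum.cong) auto
  then have norm_e: "l2_norm e \<le> l2_norm v" using l2_norm_le_sum_blocks[OF e] ij by simp
  have "mat_block n B i j *\<^sub>v v = vec_block n (B *\<^sub>v e) i"
  proof (rule eq_vecI)
    fix a assume "a < dim_vec (vec_block n (B *\<^sub>v e) i)"
    then have a: "a < n" by (simp add: vec_block_def)
    have "(B *\<^sub>v e) $ (i * n + a) = (\<Sum>h<q. \<Sum>b<n. B $$ (i * n + a, h * n + b) * e $ (h * n + b))"
      using B e block_index_less[OF ij(1) a] by (subst mult_mat_vec_index_sum) (auto simp: sum_block)
    also have "\<dots> = (\<Sum>h<q. if h = j then \<Sum>b<n. B $$ (i * n + a, h * n + b) * v $ b else 0)"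
      by (intro sum.cong) (auto simp: e_index)
    also have "\<dots> = (mat_block n B i j *\<^sub>v v) $ a"
      using ij a v by (subst mult_mat_vec_index_sum) (auto simp: mat_block_def)
    finally show "(mat_block n B i j *\<^sub>v v) $ a = vec_block n (B *\<^sub>v e) i $ a"
      using a by (simp add: vec_block_def)
  qed (simp add: mat_block_def vec_block_def)
  then have "l2_norm (mat_block n B i j *\<^sub>v v) \<le> l2_norm (B *\<^sub>v e)"
    using l2_norm_block_le[OF mult_mat_vec_carrier[OF B e] ij(1)] by simp
  also have "\<dots> \<le> spectral_norm B * l2_norm e"
    using B e by (intro l2_norm_mult_mat_vec_le) auto
  also have "\<dots> \<le> spectral_norm B * l2_norm v"
    using norm_e by (intro mult_left_mono) auto
  finally show "l2_norm (mat_block n B i j *\<^sub>v v) \<le> spectral_norm B * l2_norm v" .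
qed simp

lemma spectral_norm_mp_coeff_le_coeff_row:
  assumes P: "P \<in> carrier_mat n n" and "i \<le> d"
  shows "spectral_norm (mp_coeff P i) \<le> spectral_norm (coeff_row d P)"
proof -
  have R: "coeff_row d P \<in> carrier_mat (1 * n) ((d + 1) * n)" using P by (simp add: coeff_row_def)
  have "mat_block n (coeff_row d P) 0 i = mp_coeff P i"
    using P assms(2) block_index_less[of i "d + 1" _ n]
    by (intro eq_matI) (auto simp: mat_block_def coeff_row_def mp_coeff_def)
  then show ?thesis using spectral_norm_mat_block_le[OF R, of 0 i] assms(2) by simp
qed

lemma mp_right_eigenvectorD:
  assumes "mp_right_eigenvector P z x" "P \<in> carrier_mat r c"
  shows "x \<in> carrier_vec c" "x \<noteq> 0\<^sub>v c" "mp_eval P z *\<^sub>v x = 0\<^sub>v r"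
  using assms by (auto simp: mp_right_eigenvector_def)

lemma mp_left_eigenvectorD:
  assumes "mp_left_eigenvector P z y" "P \<in> carrier_mat r c"
  shows "mp_right_eigenvector P\<^sup>T z (conjugate y)"
proof -
  have y: "y \<in> carrier_vec r" "y \<noteq> 0\<^sub>v r"
    and null: "mat_of_rows r [conjugate y] * mp_eval P z = 0\<^sub>m 1 c"
    using assms by (auto simp: mp_left_eigenvector_def)
  have "conjugate y \<noteq> 0\<^sub>v r" using y by (metis conjugate_id conjugate_zero_vec)
  moreover have "((mp_eval P z)\<^sup>T *\<^sub>v conjugate y) $ j = 0" if j: "j < c" for j
  proof -
    have "0 = (mat_of_rows r [conjugate y] * mp_eval P z) $$ (0, j)" using null j by simp
    also have "\<dots> = conjugate y \<bullet> col (mp_eval P z) j"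
      using y j assms(2) by (subst index_mult_mat) (auto simp: mat_of_rows_row)
    also have "\<dots> = col (mp_eval P z) j \<bullet> conjugate y"
      using y j assms(2) by (intro comm_scalar_prod[of _ r]) auto
    also have "\<dots> = ((mp_eval P z)\<^sup>T *\<^sub>v conjugate y) $ j" using j assms(2) by simp
    finally show ?thesis by simp
  qed
  then have "(mp_eval P z)\<^sup>T *\<^sub>v conjugate y = 0\<^sub>v c" using assms(2) by (intro eq_vecI) auto
  ultimately show ?thesis
    using y assms(2) by (auto simp: mp_right_eigenvector_def mp_eval_transpose)
qed

lemma mp_simple_eigenvalue_transpose:
  assumes "P \<in> carrier_mat n n"
  shows "mp_simple_eigenvalue P\<^sup>T z \<longleftrightarrow> mp_simple_eigenvalue P z"
  using assms by (simp add: mp_simple_eigenvalue_def det_transpose)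

lemma transpose_null_scalar_prod:
  fixes A :: "'a::comm_ring_1 mat"
  assumes A: "A \<in> carrier_mat r c" and y: "y \<in> carrier_vec r" and v: "v \<in> carrier_vec c"
    and null: "A\<^sup>T *\<^sub>v y = 0\<^sub>v c"
  shows "y \<bullet> (A *\<^sub>v v) = 0"
  using transpose_vec_mult_scalar[OF A v y] v unfolding null by simp

text \<open>Differentiating the bilinear identity of \<open>block_kronecker_bilinear\<close> at \<open>z\<close>: on both sides
  the terms in which a vector is differentiated vanish, since the matrix then hits a null vector.\<close>

lemma block_kronecker_deriv:
  assumes cond: "block_kronecker_condition \<epsilon> n \<eta> l M P"
    and L: "L = block_kronecker_form \<epsilon> n \<eta> l M"
    and v: "v \<in> carrier_vec n" and w: "w \<in> carrier_vec n"
    and s: "s \<in> carrier_vec (\<eta> * n)" and t: "t \<in> carrier_vec (\<epsilon> * n)"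
    and x: "x = (kronecker (Lambda_mat \<epsilon> (z ^ l)) (1\<^sub>m n) *\<^sub>v v) @\<^sub>v s"
    and y: "y = (kronecker (Lambda_mat \<eta> (z ^ l)) (1\<^sub>m n) *\<^sub>v w) @\<^sub>v t"
    and Lx: "mp_eval L z *\<^sub>v x = 0\<^sub>v ((\<eta> + 1) * n + \<epsilon> * n)"
    and Ly: "(mp_eval L z)\<^sup>T *\<^sub>v y = 0\<^sub>v ((\<epsilon> + 1) * n + \<eta> * n)"
  shows "y \<bullet> (mp_eval (mp_deriv L) z *\<^sub>v x) = w \<bullet> (mp_eval (mp_deriv P) z *\<^sub>v v)"
proof -
  let ?X = "(kronecker (Lambda_mat \<epsilon> (monom 1 l)) (1\<^sub>m n) *\<^sub>v vp_const v) @\<^sub>v vp_const s"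
  let ?Y = "(kronecker (Lambda_mat \<eta> (monom 1 l)) (1\<^sub>m n) *\<^sub>v vp_const w) @\<^sub>v vp_const t"
  let ?c = "(\<epsilon> + 1) * n + \<eta> * n" and ?r = "(\<eta> + 1) * n + \<epsilon> * n"
  note P = block_kronecker_condition_carrier(2)[OF cond]
  have Lc: "L \<in> carrier_mat ?r ?c"
    unfolding L by (rule block_kronecker_form_carrier[OF block_kronecker_condition_carrier(1)[OF cond]])
  have X: "?X \<in> carrier_vec ?c"
    using v s by (intro append_carrier_vec Lambda_block_mult_vec_carrier) auto
  have Y: "?Y \<in> carrier_vec ?r"
    using w t by (intro append_carrier_vec Lambda_block_mult_vec_carrier) auto
  have Xz: "vp_eval ?X z = x" and Yz: "vp_eval ?Y z = y"
    using v w x y by (simp_all add: vp_eval_kronecker_Lambda_mat)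
  have yc: "y \<in> carrier_vec ?r" using Y unfolding Yz[symmetric] vp_eval_carrier .
  have dX: "vp_eval (map_vec pderiv ?X) z \<in> carrier_vec ?c"
    unfolding vp_eval_carrier using X by (simp only: map_carrier_vec)
  have dY: "vp_eval (map_vec pderiv ?Y) z \<in> carrier_vec ?r"
    unfolding vp_eval_carrier using Y by (simp only: map_carrier_vec)
  have "poly (pderiv (?Y \<bullet> (L *\<^sub>v ?X))) z
      = vp_eval (map_vec pderiv ?Y) z \<bullet> (mp_eval L z *\<^sub>v x) + y \<bullet> (mp_eval (mp_deriv L) z *\<^sub>v x)
        + y \<bullet> (mp_eval L z *\<^sub>v vp_eval (map_vec pderiv ?X) z)"
    unfolding pderiv_scalar_prod_mult_mat_vec[OF Lc X Y] Xz Yz ..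
  also have "vp_eval (map_vec pderiv ?Y) z \<bullet> (mp_eval L z *\<^sub>v x) = 0"
    unfolding Lx by (rule scalar_prod_right_zero[OF dY])
  also have "y \<bullet> (mp_eval L z *\<^sub>v vp_eval (map_vec pderiv ?X) z) = 0"
    using Lc by (intro transpose_null_scalar_prod[OF _ yc dX Ly]) (simp only: mp_eval_carrier)
  finally have lhs: "poly (pderiv (?Y \<bullet> (L *\<^sub>v ?X))) z = y \<bullet> (mp_eval (mp_deriv L) z *\<^sub>v x)"
    by simp
  have 0: "vp_eval (map_vec pderiv (vp_const u)) z = 0\<^sub>v n" if "u \<in> carrier_vec n" for u
    using that by (auto simp: vp_eval_def)
  have "poly (pderiv (vp_const w \<bullet> (P *\<^sub>v vp_const v))) z
      = 0\<^sub>v n \<bullet> (mp_eval P z *\<^sub>v v) + w \<bullet> (mp_eval (mp_deriv P) z *\<^sub>v v) + w \<bullet> (mp_eval P z *\<^sub>v 0\<^sub>v n)"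
    using pderiv_scalar_prod_mult_mat_vec[OF P, of "vp_const v" "vp_const w" z] v w
    by (simp add: 0)
  also have "mp_eval P z *\<^sub>v 0\<^sub>v n = 0\<^sub>v n" using P by (intro eq_vecI) auto
  finally have rhs: "poly (pderiv (vp_const w \<bullet> (P *\<^sub>v vp_const v))) z = w \<bullet> (mp_eval (mp_deriv P) z *\<^sub>v v)"
    using w v P mult_mat_vec_carrier[of "mp_eval P z" n n v] by simp
  have "?Y \<bullet> (L *\<^sub>v ?X) = vp_const w \<bullet> (P *\<^sub>v vp_const v)"
    unfolding L using v w s t by (intro block_kronecker_bilinear[OF cond]) auto
  then show ?thesis using lhs rhs by simp
qed

section \<open>Comparison of the condition numbers\<close>

definition vector_growth :: "nat \<Rightarrow> real" where
  "vector_growth d = (1 + (real d)\<^sup>2 * ((real d + 1) * (real d)\<^sup>2)) * real d"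

lemma vector_growth_ge:
  assumes "\<eta> \<le> d" "l \<le> d" "\<epsilon> + 1 \<le> d"
  shows "(1 + (real \<eta>)\<^sup>2 * ((real l + 1) * (real d)\<^sup>2)) * (real \<epsilon> + 1) \<le> vector_growth d"
  unfolding vector_growth_def using assms
  by (intro mult_mono add_mono mult_right_mono power_mono) auto

lemma block_kronecker_cond_bound:
  assumes d: "d \<ge> 1" and P: "P \<in> carrier_mat n n" and l: "l \<ge> 1"
    and comp: "block_kronecker_companion_form n d l P L"
    and simple: "mp_simple_eigenvalue P z" and z: "z \<noteq> 0"
    and x: "mp_right_eigenvector P z x" and y: "mp_left_eigenvector P z y"
    and x': "mp_right_eigenvector L z x'" and y': "mp_left_eigenvector L z y'"
    and le1: "\<And>i. i \<le> d \<Longrightarrow> spectral_norm (mp_coeff P i) \<le> 1"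
    and S: "max 1 (cmod z) ^ d \<le> S"
  shows "coeff_cond l L z x' y'
      / (S * l2_norm x * l2_norm y / (cmod z * cmod (conjugate y \<bullet> (mp_eval (mp_deriv P) z *\<^sub>v x))))
    \<le> (real d + 1) * (3 * (real d)\<^sup>2) * (vector_growth d)\<^sup>2"
proof -
  obtain \<epsilon> \<eta> M where ld: "l dvd d" and deg: "\<epsilon> + \<eta> + 1 = d div l"
    and cond: "block_kronecker_condition \<epsilon> n \<eta> l M P"
    and L: "L = block_kronecker_form \<epsilon> n \<eta> l M"
    and blocks: "\<forall>t\<le>l. \<forall>i\<le>\<eta>. \<forall>j\<le>\<epsilon>.
      mat_block n (mp_coeff M t) i j \<in> {0\<^sub>m n n, 1\<^sub>m n} \<union> mp_coeff P ` {0..d}"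
    using comp unfolding block_kronecker_companion_form_def by blast
  define \<mu> where "\<mu> = max 1 (cmod z)"
  define K where "K = vector_growth d"
  let ?c = "(\<epsilon> + 1) * n + \<eta> * n" and ?r = "(\<eta> + 1) * n + \<epsilon> * n"
  have d_eq: "d = l * (\<epsilon> + \<eta> + 1)" using ld deg by simp
  have l_le: "l \<le> d" unfolding d_eq by simp
  have sum_le: "\<epsilon> + \<eta> + 1 \<le> d" using mult_le_mono1[OF l, of "\<epsilon> + \<eta> + 1"] unfolding d_eq by (simp only: mult_1)
  have small: "\<epsilon> + 1 \<le> d" "\<eta> + 1 \<le> d" "\<epsilon> \<le> d" "\<eta> \<le> d" using sum_le by auto
  note M = block_kronecker_condition_carrier(1)[OF cond]
  have Lc: "L \<in> carrier_mat ?r ?c" unfolding L by (rule block_kronecker_form_carrier[OF M])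
  have M_le: "spectral_norm (mp_coeff M t) \<le> (real d)\<^sup>2" if t: "t \<le> l" for t
  proof -
    have "spectral_norm (mat_block n (mp_coeff M t) i j) \<le> 1" if "i < \<eta> + 1" "j < \<epsilon> + 1" for i j
    proof -
      have "mat_block n (mp_coeff M t) i j \<in> {0\<^sub>m n n, 1\<^sub>m n} \<union> mp_coeff P ` {0..d}"
        using blocks t that by auto
      moreover have "spectral_norm (1\<^sub>m n) \<le> 1"
        by (rule spectral_norm_le) auto
      ultimately show ?thesis using le1 by auto
    qed
    then have "(\<Sum>i<\<eta> + 1. \<Sum>j<\<epsilon> + 1. spectral_norm (mat_block n (mp_coeff M t) i j))
        \<le> (\<Sum>i<\<eta> + 1. \<Sum>j<\<epsilon> + 1. 1)"
      by (intro sum_mono) auto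
    also have "\<dots> = (real \<eta> + 1) * (real \<epsilon> + 1)" by (simp add: algebra_simps)
    also have "\<dots> \<le> real d * real d" using small by (intro mult_mono) auto
    finally show ?thesis
      using spectral_norm_le_sum_blocks[of "mp_coeff M t" "\<eta> + 1" n "\<epsilon> + 1"] M
      unfolding mp_coeff_carrier power2_eq_square by (meson order_trans)
  qed
  have L_le: "spectral_norm (mp_coeff L t) \<le> 3 * (real d)\<^sup>2" if t: "t \<le> l" for t
  proof -
    have "(real \<eta> + 1) * real \<eta> \<le> real d * real d" "real \<epsilon> * (real \<epsilon> + 1) \<le> real d * real d"
      using small by (auto intro!: mult_mono)
    then show ?thesis
      using spectral_norm_mp_coeff_block_kronecker_form_le[OF M, of l t] M_le[OF t]
      by (simp add: L power2_eq_square)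
  qed
  have LT: "L\<^sup>T = block_kronecker_form \<eta> n \<epsilon> l M\<^sup>T"
    unfolding L by (rule block_kronecker_form_transpose[OF M])
  note xD = mp_right_eigenvectorD[OF x P]
  note x'D = mp_right_eigenvectorD[OF x' Lc]
  have PT: "P\<^sup>T \<in> carrier_mat n n" using P by simp
  have LTc: "L\<^sup>T \<in> carrier_mat ?c ?r" using Lc by (simp only: transpose_carrier_mat)
  note yD = mp_right_eigenvectorD[OF mp_left_eigenvectorD[OF y P] PT]
  note y'D = mp_right_eigenvectorD[OF mp_left_eigenvectorD[OF y' Lc] LTc]
  obtain v s where v: "v \<in> carrier_vec n" and s: "s \<in> carrier_vec (\<eta> * n)"
    and x'_eq: "x' = (kronecker (Lambda_mat \<epsilon> (z ^ l)) (1\<^sub>m n) *\<^sub>v v) @\<^sub>v s"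
    and Pv: "mp_eval P z *\<^sub>v v = 0\<^sub>v n"
    and x'_le: "l2_norm x' \<le> (1 + (real \<eta>)\<^sup>2 * ((real l + 1) * (real d)\<^sup>2)) * (real \<epsilon> + 1)
      * max 1 (cmod z) ^ (l * \<epsilon>) * l2_norm v"
    using block_kronecker_null_vector[OF cond x'D(1) x'D(3)[unfolded L] M_le] by metis
  have MT_le: "spectral_norm (mp_coeff M\<^sup>T t) \<le> (real d)\<^sup>2" if "t \<le> l" for t
    using M_le[OF that] by (simp add: mp_coeff_transpose)
  obtain w t where w: "w \<in> carrier_vec n" and t: "t \<in> carrier_vec (\<epsilon> * n)"
    and y'_eq: "conjugate y' = (kronecker (Lambda_mat \<eta> (z ^ l)) (1\<^sub>m n) *\<^sub>v w) @\<^sub>v t"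
    and Pw: "mp_eval P\<^sup>T z *\<^sub>v w = 0\<^sub>v n"
    and y'_le: "l2_norm (conjugate y') \<le> (1 + (real \<epsilon>)\<^sup>2 * ((real l + 1) * (real d)\<^sup>2)) * (real \<eta> + 1)
      * max 1 (cmod z) ^ (l * \<eta>) * l2_norm w"
    using block_kronecker_null_vector[OF block_kronecker_condition_transpose[OF cond] y'D(1)
        y'D(3)[unfolded LT] MT_le] by metis
  obtain a where a: "v = a \<cdot>\<^sub>v x"
    using simple_eigenvalue_kernel[OF P simple xD v Pv] by blast
  obtain b where b: "w = b \<cdot>\<^sub>v conjugate y"
    using simple_eigenvalue_kernel[OF PT _ yD w Pw] simple mp_simple_eigenvalue_transpose[OF P] by blast
  have nx': "l2_norm x' \<le> K * \<mu> ^ (l * \<epsilon>) * (cmod a * l2_norm x)"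
  proof -
    have "l2_norm x' \<le> K * \<mu> ^ (l * \<epsilon>) * l2_norm v"
      unfolding K_def \<mu>_def using small l_le
      by (intro order_trans[OF x'_le] mult_right_mono vector_growth_ge) auto
    then show ?thesis by (simp add: a l2_norm_smult)
  qed
  have ny': "l2_norm y' \<le> K * \<mu> ^ (l * \<eta>) * (cmod b * l2_norm y)"
  proof -
    have "l2_norm (conjugate y') \<le> K * \<mu> ^ (l * \<eta>) * l2_norm w"
      unfolding K_def \<mu>_def using small l_le
      by (intro order_trans[OF y'_le] mult_right_mono vector_growth_ge) auto
    then show ?thesis by (simp add: b l2_norm_smult)
  qed
  have x'0: "l2_norm x' \<noteq> 0" using x'D l2_norm_eq_0_iff by blast
  have y'0: "l2_norm y' \<noteq> 0" using y'D l2_norm_eq_0_iff[of "conjugate y'"] by auto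
  have "0 < l2_norm x'" "0 < l2_norm y'" using x'0 y'0 by (simp_all add: less_le)
  then have a0: "a \<noteq> 0" and b0: "b \<noteq> 0" using nx' ny' by auto
  have x0: "l2_norm x > 0" using xD l2_norm_eq_0_iff l2_norm_nonneg[of x] by (metis less_le)
  have y0: "l2_norm y > 0"
    using yD l2_norm_eq_0_iff[of "conjugate y" n] l2_norm_nonneg[of y] by (metis l2_norm_conjugate less_le)
  define \<Delta> where "\<Delta> = cmod (conjugate y \<bullet> (mp_eval (mp_deriv P) z *\<^sub>v x))"
  have deriv: "cmod (conjugate y' \<bullet> (mp_eval (mp_deriv L) z *\<^sub>v x')) = cmod a * cmod b * \<Delta>"
  proof -
    have DP: "mp_eval (mp_deriv P) z \<in> carrier_mat n n" using P by (simp add: mp_deriv_def)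
    have "conjugate y' \<bullet> (mp_eval (mp_deriv L) z *\<^sub>v x') = w \<bullet> (mp_eval (mp_deriv P) z *\<^sub>v v)"
      by (rule block_kronecker_deriv[OF cond L v w s t x'_eq y'_eq x'D(3)])
        (use y'D(3) in \<open>simp only: mp_eval_transpose\<close>)
    also have "\<dots> = b * (a * (conjugate y \<bullet> (mp_eval (mp_deriv P) z *\<^sub>v x)))"
      unfolding a b mult_mat_vec[OF DP xD(1)]
      using yD(1) mult_mat_vec_carrier[OF DP xD(1)] by simp
    finally show ?thesis by (simp add: norm_mult \<Delta>_def)
  qed
  define C where "C = (real d + 1) * (3 * (real d)\<^sup>2) * K\<^sup>2"
  define A where "A = (\<Sum>i\<le>l. cmod z ^ i * spectral_norm (mp_coeff L i)) * l2_norm x' * l2_norm y'"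
  have K0: "0 \<le> K" by (simp add: K_def vector_growth_def)
  have \<mu>0: "0 < \<mu>" by (simp add: \<mu>_def)
  have C0: "0 \<le> C" by (simp add: C_def)
  have S0: "0 < S" using S \<mu>0 by (metis \<mu>_def less_le_trans zero_less_power)
  have sum_L: "(\<Sum>i\<le>l. cmod z ^ i * spectral_norm (mp_coeff L i)) \<le> (real d + 1) * \<mu> ^ l * (3 * (real d)\<^sup>2)"
  proof -
    have "(\<Sum>i\<le>l. cmod z ^ i * spectral_norm (mp_coeff L i)) \<le> (real l + 1) * \<mu> ^ l * (3 * (real d)\<^sup>2)"
      unfolding \<mu>_def using L_le by (intro power_sum_le) auto
    also have "\<dots> \<le> (real d + 1) * \<mu> ^ l * (3 * (real d)\<^sup>2)"
      using l_le \<mu>0 by (intro mult_right_mono) auto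
    finally show ?thesis .
  qed
  have "A \<le> (real d + 1) * \<mu> ^ l * (3 * (real d)\<^sup>2) * (K * \<mu> ^ (l * \<epsilon>) * (cmod a * l2_norm x))
      * (K * \<mu> ^ (l * \<eta>) * (cmod b * l2_norm y))"
    unfolding A_def using K0 \<mu>0
    by (intro mult_mono sum_L nx' ny') (auto intro!: mult_nonneg_nonneg sum_nonneg)
  also have "\<dots> = C * \<mu> ^ d * (cmod a * cmod b * l2_norm x * l2_norm y)"
    unfolding C_def d_eq by (simp add: power_add distrib_left power2_eq_square mult_ac)
  also have "\<dots> \<le> C * S * (cmod a * cmod b * l2_norm x * l2_norm y)"
    using S C0 unfolding \<mu>_def by (intro mult_right_mono mult_left_mono) auto
  finally have A_le: "A \<le> C * S * (cmod a * cmod b * l2_norm x * l2_norm y)" .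
  have "A / (cmod z * (cmod a * cmod b * \<Delta>)) / (S * l2_norm x * l2_norm y / (cmod z * \<Delta>)) \<le> C"
  \<comment> \<open>\<open>\<Delta> \<noteq> 0\<close> for a simple eigenvalue, but for \<open>\<Delta> = 0\<close> both quotients would be \<open>x / 0 = 0\<close> anyway\<close>
  proof (cases "\<Delta> = 0")
    case False
    then have "A / (cmod z * (cmod a * cmod b * \<Delta>)) / (S * l2_norm x * l2_norm y / (cmod z * \<Delta>))
        = A / (S * (cmod a * cmod b * l2_norm x * l2_norm y))"
      using z by simp
    also have "\<dots> \<le> C"
      using A_le S0 a0 b0 x0 y0 by (subst pos_divide_le_eq) (auto simp: mult_ac)
    finally show ?thesis .
  qed (simp add: C0)
  then show ?thesis
    unfolding coeff_cond_def deriv A_def C_def K_def \<Delta>_def .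
qed

theorem theorem5p4:
  fixes d :: nat
  assumes "d \<ge> 1"
  shows "\<exists>C::real. C > 0 \<and>
    (\<forall>(n::nat) (P :: complex poly mat) (l::nat) (L :: complex poly mat) (z\<^sub>0::complex)
       x y x' y'.
       n \<ge> 1 \<and> P \<in> carrier_mat n n \<and> mp_degree d P \<and> mp_regular P \<and>
       l \<ge> 1 \<and> l dvd d \<and> block_kronecker_companion_form n d l P L \<and>
       mp_simple_eigenvalue P z\<^sub>0 \<and> z\<^sub>0 \<noteq> 0 \<and>
       mp_right_eigenvector P z\<^sub>0 x \<and> mp_left_eigenvector P z\<^sub>0 y \<and>
       mp_right_eigenvector L z\<^sub>0 x' \<and> mp_left_eigenvector L z\<^sub>0 y'
       \<longrightarrow>
       ((MAX i\<in>{0..d}. spectral_norm (mp_coeff P i)) = 1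
          \<longrightarrow> coeff_cond l L z\<^sub>0 x' y' / norm_cond d P z\<^sub>0 x y \<le> C) \<and>
       ((MAX i\<in>{0..d}. spectral_norm (mp_coeff P i)) = 1 \<and>
        min (spectral_norm (mp_coeff P 0)) (spectral_norm (mp_coeff P d)) = 1
          \<longrightarrow> coeff_cond l L z\<^sub>0 x' y' / coeff_cond d P z\<^sub>0 x y \<le> C))"
proof -
  define C where "C = (real d + 1) * (3 * (real d)\<^sup>2) * (vector_growth d)\<^sup>2"
  have "0 < vector_growth d"
    using assms unfolding vector_growth_def by (intro mult_pos_pos add_pos_nonneg) auto
  then have C0: "0 < C" using assms by (simp add: C_def)
  {
    fix n l :: nat and P L :: "complex poly mat" and z :: complex and x y x' y' :: "complex vec"
    assume P: "P \<in> carrier_mat n n" and l: "l \<ge> 1"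
      and comp: "block_kronecker_companion_form n d l P L"
      and simple: "mp_simple_eigenvalue P z" and z: "z \<noteq> 0"
      and vecs: "mp_right_eigenvector P z x" "mp_left_eigenvector P z y"
        "mp_right_eigenvector L z x'" "mp_left_eigenvector L z y'"
      and max: "(MAX i\<in>{0..d}. spectral_norm (mp_coeff P i)) = 1"
    have le1: "spectral_norm (mp_coeff P i) \<le> 1" if "i \<le> d" for i
      using max Max_ge[of "(\<lambda>i. spectral_norm (mp_coeff P i)) ` {0..d}" "spectral_norm (mp_coeff P i)"] that
      by auto
    note bound = block_kronecker_cond_bound[OF assms P l comp simple z vecs le1, folded C_def]
    have power_sum: "max 1 (cmod z) ^ d \<le> (\<Sum>i\<le>d. cmod z ^ i * f i)"
      if f: "f 0 \<ge> 1" "f d \<ge> 1" "\<And>i. f i \<ge> 0" for f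
    proof (cases "cmod z \<le> 1")
      case True
      have "cmod z ^ 0 * f 0 \<le> (\<Sum>i\<le>d. cmod z ^ i * f i)"
        using f by (intro member_le_sum) auto
      then have "1 \<le> (\<Sum>i\<le>d. cmod z ^ i * f i)" using f(1) by simp
      then show ?thesis using True by (simp add: max_absorb1)
    next
      case False
      have "cmod z ^ d * 1 \<le> cmod z ^ d * f d" using f by (intro mult_left_mono) auto
      also have "\<dots> \<le> (\<Sum>i\<le>d. cmod z ^ i * f i)"
        using f by (intro member_le_sum) auto
      finally show ?thesis using False by (simp add: max_def)
    qed
    have "coeff_cond l L z x' y' / norm_cond d P z x y \<le> C"
    proof -
      have "1 \<in> (\<lambda>i. spectral_norm (mp_coeff P i)) ` {0..d}"
        using Max_in[of "(\<lambda>i. spectral_norm (mp_coeff P i)) ` {0..d}"] max by auto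
      then have "1 \<le> spectral_norm (coeff_row d P)"
        using spectral_norm_mp_coeff_le_coeff_row[OF P] by fastforce
      moreover have "max 1 (cmod z) ^ d \<le> (\<Sum>i\<le>d. cmod z ^ i)"
        using power_sum[of "\<lambda>_. 1"] by simp
      ultimately have "1 * max 1 (cmod z) ^ d \<le> spectral_norm (coeff_row d P) * (\<Sum>i\<le>d. cmod z ^ i)"
        by (intro mult_mono) auto
      then show ?thesis unfolding norm_cond_def by (intro bound) auto
    qed
    moreover have "coeff_cond l L z x' y' / coeff_cond d P z x y \<le> C"
      if "min (spectral_norm (mp_coeff P 0)) (spectral_norm (mp_coeff P d)) = 1"
      unfolding coeff_cond_def[of d] using that by (intro bound power_sum) auto
    ultimately have "coeff_cond l L z x' y' / norm_cond d P z x y \<le> C"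
      "min (spectral_norm (mp_coeff P 0)) (spectral_norm (mp_coeff P d)) = 1
        \<Longrightarrow> coeff_cond l L z x' y' / coeff_cond d P z x y \<le> C"
      by blast+
  }
  then show ?thesis using C0 by (intro exI[of _ C]) blast
qed

end
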